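(* Given $f\in L^1(\Omega,\mu)$, one has (for each choice of sign, upper signs together and lower signs together) $$\int_{\Omega_\pm}f(x)\,d\mu(x)=\int_{\Gamma_\pm}d\mu_\pm(y)\int_0^{\tau_\mp(y)}f(\Phi(y,\mp s))\,ds,$$ and $$\int_{\Omega_\pm\cap\Omega_{\mp\infty}}f(x)\,d\mu(x)=\int_{\Gamma_{\pm\infty}}d\mu_\pm(y)\int_0^\infty f(\Phi(y,\mp s))\,ds .$$
   Context: Setting. $\mu$ is a positive Radon measure on $\mathbb R^N$ (a Borel measure, or the completion of one, finite on compact sets). $F:\mathbb R^N\to\mathbb R^N$ is a globally Lipschitz vector field. For $x\in\mathbb R^N$, $t\mapsto\Phi(x,t)$, $t\in\mathbb R$, is the unique global solution of $\frac{d}{dt}X(t)=F(X(t))$, $X(0)=x$. Standing assumption: $\mu(\Phi(A,t))=\mu(A)$ for every measurable $A\subset\mathbb R^N$ and $t\in\mathbb R$. $\Omega\subset\mathbb R^N$ is a (sufficiently smooth) open set. For $x\in\Omega$, $\tau_\pm(x)=\inf\{s>0:\Phi(x,\pm s)\notin\Omega\}$, with $\inf\varnothing=\infty$. The incoming ($-$) and outgoing ($+$) boundaries are $\Gamma_\pm=\{y\in\partial\Omega:\exists x\in\Omega,\ \tau_\pm(x)<\infty,\ y=\Phi(x,\pm\tau_\pm(x))\}$. For $y\in\Gamma_-$ (resp. $y\in\Gamma_+$), $\tau_+(y)$ (resp. $\tau_-(y)$) is the length of the integral curve in $\Omega$ having $y$ as left (resp. right) endpoint, i.e. $\tau_-(x)+\tau_+(x)$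 for any $x\in\Omega$ with $y=\Phi(x,-\tau_-(x))$ (resp. $y=\Phi(x,\tau_+(x))$). Boundary measures: $\mu_\pm$ are the unique positive Borel measures on $\Gamma_\pm$ such that for all $T>0$ and $f\in L^1(\Omega\times(0,T),\mu\otimes dt)$, with $\wedge$ denoting minimum, $\int_{\Omega\times(0,T)}f\,d\mu\,dt=\int_0^Tdt\int_{\Gamma_+}d\mu_+(y)\int_0^{\tau_-(y)\wedge t}f(\Phi(y,-s),t-s)ds+\int_\Omega d\mu(x)\int_0^{\tau_-(x)\wedge T}f(\Phi(x,-s),T-s)ds$ and $\int_{\Omega\times(0,T)}f\,d\mu\,dt=\int_0^Tdt\int_{\Gamma_-}d\mu_-(y)\int_0^{\tau_+(y)\wedge(T-t)}f(\Phi(y,s),t+s)ds+\int_\Omega d\mu(x)\int_0^{\tau_+(x)\wedge T}f(\Phi(x,s),s)ds$. Notation: $\Omega_\pm=\{x\in\Omega:\tau_\pm(x)<\infty\}$, $\Omega_{\pm\infty}=\{x\in\Omega:\tau_\pm(x)=\infty\}$, $\Gamma_{\pm\infty}=\{y\in\Gamma_\pm:\tau_\mp(y)=\infty\}$. *)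

theory Defs
  imports "HOL-Analysis.Analysis"
begin

text \<open>Positive Radon measures: Borel measures, or completions of Borel measures, that are finite on
  compact sets.\<close>

definition radon_measure :: "(real ^ 'n) measure \<Rightarrow> bool" where
  "radon_measure \<mu> \<longleftrightarrow>
     (\<exists>\<nu>. sets \<nu> = sets borel \<and> (\<mu> = \<nu> \<or> \<mu> = completion \<nu>)) \<and>
     (\<forall>K. compact K \<longrightarrow> emeasure \<mu> K < \<infinity>)"

text \<open>For globally Lipschitz \<open>F\<close> exactly one \<open>\<Phi>\<close> satisfies this predicate.\<close>

definition global_flow ::
  "(real ^ 'n \<Rightarrow> real ^ 'n) \<Rightarrow> (real ^ 'n \<Rightarrow> real \<Rightarrow> real ^ 'n) \<Rightarrow> bool" where
  "global_flow F \<Phi> \<longleftrightarrow>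
     (\<forall>x. \<Phi> x 0 = x \<and> (\<forall>t. (\<Phi> x has_vector_derivative F (\<Phi> x t)) (at t)))"

definition flow_invariant ::
  "(real ^ 'n) measure \<Rightarrow> (real ^ 'n \<Rightarrow> real \<Rightarrow> real ^ 'n) \<Rightarrow> bool" where
  "flow_invariant \<mu> \<Phi> \<longleftrightarrow>
     (\<forall>A\<in>sets \<mu>. \<forall>t. emeasure \<mu> ((\<lambda>x. \<Phi> x t) ` A) = emeasure \<mu> A)"

text \<open>The parameter \<open>\<sigma>\<close> encodes the choice of sign in \<open>\<tau>\<^sub>\<plusminus>\<close> and \<open>\<Gamma>\<^sub>\<plusminus>\<close>; it is only ever used
  with the values \<open>1\<close> and \<open>-1\<close>. In \<^typ>\<open>ereal\<close> the infimum of the empty set is \<open>\<infinity>\<close>.\<close>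

definition exit_time ::
  "(real ^ 'n \<Rightarrow> real \<Rightarrow> real ^ 'n) \<Rightarrow> (real ^ 'n) set \<Rightarrow> real \<Rightarrow> real ^ 'n \<Rightarrow> ereal" where
  "exit_time \<Phi> \<Omega> \<sigma> x = Inf {ereal s |s. s > 0 \<and> \<Phi> x (\<sigma> * s) \<notin> \<Omega>}"

definition flow_boundary ::
  "(real ^ 'n \<Rightarrow> real \<Rightarrow> real ^ 'n) \<Rightarrow> (real ^ 'n) set \<Rightarrow> real \<Rightarrow> (real ^ 'n) set" where
  "flow_boundary \<Phi> \<Omega> \<sigma> =
     {y \<in> frontier \<Omega>. \<exists>x\<in>\<Omega>. exit_time \<Phi> \<Omega> \<sigma> x < \<infinity> \<and>
        y = \<Phi> x (\<sigma> * real_of_ereal (exit_time \<Phi> \<Omega> \<sigma> x))}"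

text \<open>For \<open>y\<close> in \<open>flow_boundary \<Phi> \<Omega> \<sigma>\<close> this is the length of the integral curve in \<open>\<Omega>\<close> with endpoint
  \<open>y\<close>, i.e. \<open>\<tau>\<^sub>-(y)\<close> on \<open>\<Gamma>\<^sub>+\<close> (\<open>\<sigma> = 1\<close>) and \<open>\<tau>\<^sub>+(y)\<close> on \<open>\<Gamma>\<^sub>-\<close> (\<open>\<sigma> = -1\<close>). The value does not depend
  on the choice of \<open>x\<close>: any two such \<open>x\<close> lie on the same integral curve in \<open>\<Omega>\<close>.\<close>

definition curve_length ::
  "(real ^ 'n \<Rightarrow> real \<Rightarrow> real ^ 'n) \<Rightarrow> (real ^ 'n) set \<Rightarrow> real \<Rightarrow> real ^ 'n \<Rightarrow> ereal" where
  "curve_length \<Phi> \<Omega> \<sigma> y =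
     (THE l. \<exists>x\<in>\<Omega>. exit_time \<Phi> \<Omega> \<sigma> x < \<infinity> \<and>
        y = \<Phi> x (\<sigma> * real_of_ereal (exit_time \<Phi> \<Omega> \<sigma> x)) \<and>
        l = exit_time \<Phi> \<Omega> (-1) x + exit_time \<Phi> \<Omega> 1 x)"

text \<open>Absolute convergence of the iterated integral of \<open>g y s\<close> over \<open>y \<in> A\<close> and \<open>0 < s < b y\<close>, the
  inner integral being required to exist for almost every \<open>y\<close> only. It accompanies every
  iterated integral below, because a Bochner integral without integrability is \<open>0\<close> by convention.\<close>

definition iterated_integrable ::
  "'a measure \<Rightarrow> 'a set \<Rightarrow> ('a \<Rightarrow> ereal) \<Rightarrow> ('a \<Rightarrow> real \<Rightarrow> real) \<Rightarrow> bool" where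
  "iterated_integrable M A b g \<longleftrightarrow>
     (AE y in M. y \<in> A \<longrightarrow> interval_lebesgue_integrable lebesgue 0 (b y) (g y)) \<and>
     set_integrable M A (\<lambda>y. LINT s=0..b y|lebesgue. g y s)"

text \<open>The boundary measures are Borel measures on \<open>\<Gamma>\<^sub>\<plusminus>\<close>. Integrals with respect to them are taken
  over their completions: for \<open>f\<close> measurable with respect to a completed \<open>\<mu>\<close>, the inner integral agrees
  with a Borel function of \<open>y\<close> only almost everywhere. For the same reason \<open>ds\<close> and \<open>dt\<close> are
  \<^term>\<open>lebesgue\<close>.\<close>

definition outgoing_boundary_measure ::
  "(real ^ 'n) measure \<Rightarrow> (real ^ 'n \<Rightarrow> real \<Rightarrow> real ^ 'n) \<Rightarrow> (real ^ 'n) set \<Rightarrow>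
   (real ^ 'n) measure \<Rightarrow> bool" where
  "outgoing_boundary_measure \<mu> \<Phi> \<Omega> \<mu>\<^sub>p \<longleftrightarrow>
     (let \<Gamma> = flow_boundary \<Phi> \<Omega> 1;
          \<tau>\<Gamma> = curve_length \<Phi> \<Omega> 1;
          \<tau> = exit_time \<Phi> \<Omega> (-1)
      in sets \<mu>\<^sub>p = sets (restrict_space borel \<Gamma>) \<and>
       (\<forall>T>0. \<forall>f :: (real ^ 'n) \<times> real \<Rightarrow> real.
          set_integrable (\<mu> \<Otimes>\<^sub>M lborel) (\<Omega> \<times> {0<..<T}) f \<longrightarrow>
          (AE t in lebesgue. t \<in> {0<..<T} \<longrightarrow>
             iterated_integrable (completion \<mu>\<^sub>p) \<Gamma> (\<lambda>y. min (\<tau>\<Gamma> y) (ereal t))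
               (\<lambda>y s. f (\<Phi> y (- s), t - s))) \<and>
          set_integrable lebesgue {0<..<T}
            (\<lambda>t. LINT y:\<Gamma>|completion \<mu>\<^sub>p.
               LINT s=0..min (\<tau>\<Gamma> y) (ereal t)|lebesgue. f (\<Phi> y (- s), t - s)) \<and>
          iterated_integrable \<mu> \<Omega> (\<lambda>x. min (\<tau> x) (ereal T)) (\<lambda>x s. f (\<Phi> x (- s), T - s)) \<and>
          (LINT z:\<Omega> \<times> {0<..<T}|\<mu> \<Otimes>\<^sub>M lborel. f z) =
            (LINT t:{0<..<T}|lebesgue. LINT y:\<Gamma>|completion \<mu>\<^sub>p.
               LINT s=0..min (\<tau>\<Gamma> y) (ereal t)|lebesgue. f (\<Phi> y (- s), t - s)) +
            (LINT x:\<Omega>|\<mu>. LINT s=0..min (\<tau> x) (ereal T)|lebesgue. f (\<Phi> x (- s), T - s))))"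

definition incoming_boundary_measure ::
  "(real ^ 'n) measure \<Rightarrow> (real ^ 'n \<Rightarrow> real \<Rightarrow> real ^ 'n) \<Rightarrow> (real ^ 'n) set \<Rightarrow>
   (real ^ 'n) measure \<Rightarrow> bool" where
  "incoming_boundary_measure \<mu> \<Phi> \<Omega> \<mu>\<^sub>m \<longleftrightarrow>
     (let \<Gamma> = flow_boundary \<Phi> \<Omega> (-1);
          \<tau>\<Gamma> = curve_length \<Phi> \<Omega> (-1);
          \<tau> = exit_time \<Phi> \<Omega> 1
      in sets \<mu>\<^sub>m = sets (restrict_space borel \<Gamma>) \<and>
       (\<forall>T>0. \<forall>f :: (real ^ 'n) \<times> real \<Rightarrow> real.
          set_integrable (\<mu> \<Otimes>\<^sub>M lborel) (\<Omega> \<times> {0<..<T}) f \<longrightarrow>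
          (AE t in lebesgue. t \<in> {0<..<T} \<longrightarrow>
             iterated_integrable (completion \<mu>\<^sub>m) \<Gamma> (\<lambda>y. min (\<tau>\<Gamma> y) (ereal (T - t)))
               (\<lambda>y s. f (\<Phi> y s, t + s))) \<and>
          set_integrable lebesgue {0<..<T}
            (\<lambda>t. LINT y:\<Gamma>|completion \<mu>\<^sub>m.
               LINT s=0..min (\<tau>\<Gamma> y) (ereal (T - t))|lebesgue. f (\<Phi> y s, t + s)) \<and>
          iterated_integrable \<mu> \<Omega> (\<lambda>x. min (\<tau> x) (ereal T)) (\<lambda>x s. f (\<Phi> x s, s)) \<and>
          (LINT z:\<Omega> \<times> {0<..<T}|\<mu> \<Otimes>\<^sub>M lborel. f z) =
            (LINT t:{0<..<T}|lebesgue. LINT y:\<Gamma>|completion \<mu>\<^sub>m.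
               LINT s=0..min (\<tau>\<Gamma> y) (ereal (T - t))|lebesgue. f (\<Phi> y s, t + s)) +
            (LINT x:\<Omega>|\<mu>. LINT s=0..min (\<tau> x) (ereal T)|lebesgue. f (\<Phi> x s, s))))"

text \<open>\<open>finite_exit\<close> and \<open>infinite_exit\<close> are \<open>\<Omega>\<^sub>\<plusminus>\<close> and \<open>\<Omega>\<^sub>\<plusminus>\<^sub>\<infinity>\<close>; \<open>infinite_boundary\<close> is
  \<open>\<Gamma>\<^sub>\<plusminus>\<^sub>\<infinity>\<close>.\<close>

definition finite_exit ::
  "(real ^ 'n \<Rightarrow> real \<Rightarrow> real ^ 'n) \<Rightarrow> (real ^ 'n) set \<Rightarrow> real \<Rightarrow> (real ^ 'n) set" where
  "finite_exit \<Phi> \<Omega> \<sigma> = {x \<in> \<Omega>. exit_time \<Phi> \<Omega> \<sigma> x < \<infinity>}"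

definition infinite_exit ::
  "(real ^ 'n \<Rightarrow> real \<Rightarrow> real ^ 'n) \<Rightarrow> (real ^ 'n) set \<Rightarrow> real \<Rightarrow> (real ^ 'n) set" where
  "infinite_exit \<Phi> \<Omega> \<sigma> = {x \<in> \<Omega>. exit_time \<Phi> \<Omega> \<sigma> x = \<infinity>}"

definition infinite_boundary ::
  "(real ^ 'n \<Rightarrow> real \<Rightarrow> real ^ 'n) \<Rightarrow> (real ^ 'n) set \<Rightarrow> real \<Rightarrow> (real ^ 'n) set" where
  "infinite_boundary \<Phi> \<Omega> \<sigma> = {y \<in> flow_boundary \<Phi> \<Omega> \<sigma>. curve_length \<Phi> \<Omega> \<sigma> y = \<infinity>}"

end

theory Submission
  imports Defs
begin

text \<open>A point \<open>x\<close> of \<open>\<Omega>\<close> that leaves \<open>\<Omega>\<close> in finite time is \<open>\<Phi> y (- s)\<close> for its exit point \<open>y\<close> and its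
  exit time \<open>s\<close>, and the claim is that \<open>\<mu>\<close> is the product of \<open>\<mu>\<^sub>p\<close> and \<open>ds\<close> in these coordinates. The
  formula that defines \<open>\<mu>\<^sub>p\<close> says this in space-time, with one more term for the trajectories that are
  still inside at the terminal time.

  To descend to space, let \<open>p\<close> be the exit time and apply the formula on the time interval
  \<open>(0, a + 1)\<close> to the test function \<open>f x\<close> restricted to \<open>p x < a < t + p x < a + 1\<close>. Along a
  trajectory \<open>t + p\<close> is constant: it is the time of exit. The restriction therefore selects the
  trajectories that exit between the times \<open>a\<close> and \<open>a + 1\<close>. These are not inside at the terminal time,
  so that the additional term vanishes; and the window has length one, so that the integration over
  time has no effect on either side. What remains is the claim for \<open>f\<close> restricted to \<open>p < a\<close>, with
  the inner integral cut off at \<open>a\<close> (\<open>truncated_boundary_identity\<close>).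

  Letting \<open>a\<close> tend to infinity gives the first identity (\<open>outgoing_identity\<close>); monotone convergence for
  \<open>\<bar>f\<bar>\<close> yields the integrability assertions and a dominating function for \<open>f\<close>
  (\<open>iterated_integrable_exhaust\<close>). The second identity is the first one for \<open>f\<close> times the indicator of
  the points with infinite backward exit time (\<open>outgoing_identity_infinite\<close>). The incoming case is the
  outgoing case for the reversed flow (\<open>incoming_imp_outgoing_reverse\<close>).

  The flow enters through continuity, which makes exit times Borel, and through the group law, which
  makes \<open>t + p\<close> constant along trajectories; both follow from Gronwall's inequality.\<close>

section \<open>The flow of a Lipschitz field\<close>

text \<open>Gronwall's inequality in its simplest form: \<open>exp (- 2 L t)\<close> times the squared distance of two
  solutions has nonpositive derivative. Uniqueness of solutions is the case of equal initial values.\<close>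

lemma lipschitz_trajectories_forward:
  fixes F :: "'a::real_inner \<Rightarrow> 'a"
  assumes F: "L-lipschitz_on UNIV F"
    and X: "\<And>t. (X has_vector_derivative F (X t)) (at t)"
    and Y: "\<And>t. (Y has_vector_derivative F (Y t)) (at t)"
    and t: "0 \<le> t"
  shows "norm (X t - Y t) \<le> exp (L * t) * norm (X 0 - Y 0)"
proof -
  define D where "D = (\<lambda>t. X t - Y t)"
  define u where "u = (\<lambda>t. exp (- 2 * L * t) * (D t \<bullet> D t))"
  have D: "(D has_vector_derivative F (X t) - F (Y t)) (at t)" for t
    unfolding D_def by (intro has_vector_derivative_diff X Y)
  have DD: "((\<lambda>t. D t \<bullet> D t) has_real_derivative 2 * (D t \<bullet> (F (X t) - F (Y t)))) (at t)" for t
    using bounded_bilinear.has_vector_derivative[OF bounded_bilinear_inner D D, of t]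
    by (simp add: has_real_derivative_iff_has_vector_derivative inner_commute)
  have du: "(u has_real_derivative
      exp (- 2 * L * t) * (2 * (D t \<bullet> (F (X t) - F (Y t)) - L * (D t \<bullet> D t)))) (at t)" for t
    unfolding u_def by (rule derivative_eq_intros DD refl | simp add: algebra_simps)+
  have "D t \<bullet> (F (X t) - F (Y t)) \<le> L * (D t \<bullet> D t)" for t
  proof -
    have "D t \<bullet> (F (X t) - F (Y t)) \<le> norm (D t) * norm (F (X t) - F (Y t))"
      by (rule norm_cauchy_schwarz)
    also have "\<dots> \<le> norm (D t) * (L * norm (D t))"
      using lipschitz_onD[OF F, of "X t" "Y t"] by (intro mult_left_mono) (auto simp: D_def dist_norm)
    finally show ?thesis by (simp add: power2_norm_eq_inner[symmetric] power2_eq_square ac_simps)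
  qed
  then have "u t \<le> u 0"
    using t by (intro DERIV_nonpos_imp_nonincreasing[of 0 t u]) (auto intro!: exI du mult_nonneg_nonpos)
  then have "(norm (D t))\<^sup>2 \<le> (exp (L * t) * norm (D 0))\<^sup>2"
    by (simp add: u_def power2_norm_eq_inner power_mult_distrib exp_minus divide_simps
        flip: exp_double)
      (simp add: exp_of_nat_mult[symmetric] ac_simps)
  then have "norm (D t) \<le> exp (L * t) * norm (D 0)"
    by (rule power2_le_imp_le) simp
  then show ?thesis by (simp add: D_def)
qed

lemma lipschitz_trajectories:
  fixes F :: "'a::real_inner \<Rightarrow> 'a"
  assumes F: "L-lipschitz_on UNIV F"
    and X: "\<And>t. (X has_vector_derivative F (X t)) (at t)"
    and Y: "\<And>t. (Y has_vector_derivative F (Y t)) (at t)"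
  shows "norm (X t - Y t) \<le> exp (L * \<bar>t\<bar>) * norm (X 0 - Y 0)"
proof (cases "0 \<le> t")
  case True
  then show ?thesis using lipschitz_trajectories_forward[OF assms] by simp
next
  case False
  have rev: "((\<lambda>t. Z (- t)) has_vector_derivative - F (Z (- t))) (at t)"
    if Z: "\<And>t. (Z has_vector_derivative F (Z t)) (at t)" for Z t
    using vector_diff_chain_at[OF has_vector_derivative_minus[OF has_vector_derivative_id] Z]
    by (simp add: o_def)
  have "L-lipschitz_on UNIV (\<lambda>x. - F x)"
    using F by simp
  from lipschitz_trajectories_forward[OF this rev[OF X] rev[OF Y], of "- t"] False
  show ?thesis by simp
qed

text \<open>Stated without the vector field, so that these axioms are symmetric under time reversal.\<close>

locale continuous_flow =
  fixes \<Phi> :: "real ^ 'n \<Rightarrow> real \<Rightarrow> real ^ 'n"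
  assumes flow_zero: "\<Phi> x 0 = x"
    and flow_flow: "\<Phi> (\<Phi> x s) t = \<Phi> x (s + t)"
    and flow_continuous: "continuous_on UNIV (\<lambda>(x, t). \<Phi> x t)"

lemma continuous_flow_reverse:
  assumes "continuous_flow \<Phi>"
  shows "continuous_flow (\<lambda>x t. \<Phi> x (- t))"
proof -
  interpret continuous_flow \<Phi> by fact
  have "continuous_on UNIV (\<lambda>z. (\<lambda>(x, t). \<Phi> x t) (fst z, - snd z))"
    by (rule continuous_on_compose2[OF flow_continuous]) (auto intro!: continuous_intros)
  then show ?thesis
    by unfold_locales (simp_all add: flow_zero flow_flow case_prod_beta)
qed

text \<open>The group law is uniqueness of solutions. For joint continuity, the exponential bound controls
  the dependence on the initial point uniformly over bounded times.\<close>

lemma global_flow_continuous_flow: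
  fixes F :: "real ^ 'n \<Rightarrow> real ^ 'n"
  assumes F: "L-lipschitz_on UNIV F" and \<Phi>: "global_flow F \<Phi>"
  shows "continuous_flow \<Phi>"
proof
  have zero: "\<Phi> x 0 = x" and der: "(\<Phi> x has_vector_derivative F (\<Phi> x t)) (at t)" for x t
    using \<Phi> by (auto simp: global_flow_def)
  show "\<Phi> x 0 = x" for x by (rule zero)
  show "\<Phi> (\<Phi> x s) t = \<Phi> x (s + t)" for x s t
  proof -
    have "((\<lambda>t. \<Phi> x (s + t)) has_vector_derivative F (\<Phi> x (s + t))) (at t)" for t
    proof -
      have "((\<lambda>t. s + t) has_vector_derivative 0 + 1) (at t)"
        by (rule has_vector_derivative_add[OF has_vector_derivative_const has_vector_derivative_id])
      then have "(\<Phi> x \<circ> (\<lambda>t. s + t) has_vector_derivative (0 + 1) *\<^sub>R F (\<Phi> x (s + t))) (at t)"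
        by (rule vector_diff_chain_at[OF _ der])
      then show ?thesis by (simp add: o_def)
    qed
    then have "norm (\<Phi> (\<Phi> x s) t - \<Phi> x (s + t))
        \<le> exp (L * \<bar>t\<bar>) * norm (\<Phi> (\<Phi> x s) 0 - \<Phi> x (s + 0))"
      by (rule lipschitz_trajectories[OF F der])
    then show ?thesis by (simp add: zero)
  qed
  have "((\<lambda>z. \<Phi> (fst z) (snd z)) \<longlongrightarrow> \<Phi> x t) (at (x, t))" for x t
  proof -
    let ?b = "\<lambda>z. exp (L * \<bar>snd z\<bar>) * norm (fst z - x) + norm (\<Phi> x (snd z) - \<Phi> x t)"
    have "(\<Phi> x \<longlongrightarrow> \<Phi> x t) (at t)"
      using has_vector_derivative_continuous[OF der] by (simp add: continuous_at)
    then have "isCont (\<Phi> x) t" by (simp add: isCont_def)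
    moreover have "((\<lambda>z. snd z) \<longlongrightarrow> t) (at (x, t))"
      using tendsto_snd[OF tendsto_ident_at, of "(x, t)" UNIV] by simp
    ultimately have "((\<lambda>z. \<Phi> x (snd z)) \<longlongrightarrow> \<Phi> x t) (at (x, t))"
      by (rule isCont_tendsto_compose)
    then have "(?b \<longlongrightarrow> exp (L * \<bar>t\<bar>) * norm (x - x) + norm (\<Phi> x t - \<Phi> x t)) (at (x, t))"
      by (intro tendsto_intros) (auto intro!: tendsto_eq_intros)
    then have lim: "(?b \<longlongrightarrow> 0) (at (x, t))" by simp
    have "norm (\<Phi> (fst z) (snd z) - \<Phi> x t) \<le> ?b z" for z
      using lipschitz_trajectories[OF F der[of "fst z"] der[of x], of "snd z"]
        norm_triangle_ineq[of "\<Phi> (fst z) (snd z) - \<Phi> x (snd z)" "\<Phi> x (snd z) - \<Phi> x t"]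
      by (simp add: zero)
    then show ?thesis
      by (intro Lim_transform_bound[OF _ lim, THEN LIM_zero_cancel] always_eventually)
         auto
  qed
  then show "continuous_on UNIV (\<lambda>(x, t). \<Phi> x t)"
    by (auto simp: continuous_on_eq_continuous_at isCont_def case_prod_beta)
qed

section \<open>Exit times and boundary points\<close>

lemma le_exit_time_iff:
  "c \<le> exit_time \<Phi> \<Omega> \<sigma> x \<longleftrightarrow> (\<forall>s>0. ereal s < c \<longrightarrow> \<Phi> x (\<sigma> * s) \<in> \<Omega>)"
  unfolding exit_time_def le_Inf_iff by (auto simp: not_le[symmetric])

lemma exit_time_nonneg: "0 \<le> exit_time \<Phi> \<Omega> \<sigma> x"
  by (auto simp: le_exit_time_iff simp flip: zero_ereal_def)

lemma exit_time_le: "s > 0 \<Longrightarrow> \<Phi> x (\<sigma> * s) \<notin> \<Omega> \<Longrightarrow> exit_time \<Phi> \<Omega> \<sigma> x \<le> ereal s"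
  unfolding exit_time_def by (auto intro!: Inf_lower)

lemma before_exit_time: "s > 0 \<Longrightarrow> ereal s < exit_time \<Phi> \<Omega> \<sigma> x \<Longrightarrow> \<Phi> x (\<sigma> * s) \<in> \<Omega>"
  using exit_time_le[of s \<Phi> x \<sigma> \<Omega>] by (auto simp: not_le[symmetric])

lemma curve_length_reverse:
  "curve_length (\<lambda>x t. \<Phi> x (- t)) \<Omega> 1 y = curve_length \<Phi> \<Omega> (-1) y"
  by (simp add: curve_length_def exit_time_def add.commute)

lemma flow_boundary_reverse:
  "flow_boundary (\<lambda>x t. \<Phi> x (- t)) \<Omega> 1 = flow_boundary \<Phi> \<Omega> (-1)"
  by (simp add: flow_boundary_def exit_time_def)

context continuous_flow
begin

text \<open>Following the flow as long as it stays in \<open>\<Omega>\<close> shortens the exit time by the time elapsed. Every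
  computation of an exit time along a trajectory reduces to this. The hypothesis
  exempts time zero, so that the lemma also applies at points of the boundary.\<close>

lemma exit_time_after:
  assumes p: "0 \<le> p" and inside: "\<And>r. 0 < r \<Longrightarrow> r \<le> p \<Longrightarrow> \<Phi> x (\<sigma> * r) \<in> \<Omega>"
  shows "exit_time \<Phi> \<Omega> \<sigma> x = ereal p + exit_time \<Phi> \<Omega> \<sigma> (\<Phi> x (\<sigma> * p))"
proof (rule antisym)
  let ?E = "exit_time \<Phi> \<Omega> \<sigma> (\<Phi> x (\<sigma> * p))"
  have shift: "\<Phi> (\<Phi> x (\<sigma> * p)) (\<sigma> * s) = \<Phi> x (\<sigma> * (p + s))" for s
    by (simp add: flow_flow distrib_left)
  show "ereal p + ?E \<le> exit_time \<Phi> \<Omega> \<sigma> x"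
    unfolding le_exit_time_iff
  proof (intro allI impI)
    fix s assume s: "0 < s" "ereal s < ereal p + ?E"
    show "\<Phi> x (\<sigma> * s) \<in> \<Omega>"
    proof (cases "s \<le> p")
      case False
      have "ereal (s - p) < ?E"
        using s by (cases ?E) auto
      then show ?thesis
        using before_exit_time[of "s - p" \<Phi> \<Omega> \<sigma> "\<Phi> x (\<sigma> * p)"] False by (simp add: shift)
    qed (use inside s in auto)
  qed
  have "exit_time \<Phi> \<Omega> \<sigma> x - ereal p \<le> ?E"
    unfolding le_exit_time_iff
  proof (intro allI impI)
    fix s assume s: "0 < s" "ereal s < exit_time \<Phi> \<Omega> \<sigma> x - ereal p"
    then have "ereal (p + s) < exit_time \<Phi> \<Omega> \<sigma> x"
      by (cases "exit_time \<Phi> \<Omega> \<sigma> x") auto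
    then show "\<Phi> (\<Phi> x (\<sigma> * p)) (\<sigma> * s) \<in> \<Omega>"
      using before_exit_time[of "p + s" \<Phi> \<Omega> \<sigma> x] s p by (simp add: shift)
  qed
  then show "exit_time \<Phi> \<Omega> \<sigma> x \<le> ereal p + ?E"
    by (cases "exit_time \<Phi> \<Omega> \<sigma> x"; cases ?E) auto
qed

text \<open>To leave \<open>\<Omega>\<close> before time \<open>c\<close> is to be outside \<open>\<Omega>\<close> at some time in a compact interval with
  rational endpoints inside \<open>(0, c)\<close>. For each such interval the set of starting points is the
  projection of a closed set along a compact factor, hence closed.\<close>

lemma borel_measurable_exit_time:
  assumes "open \<Omega>"
  shows "exit_time \<Phi> \<Omega> \<sigma> \<in> borel_measurable borel"
proof (rule borel_measurableI_less)
  fix c :: ereal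
  define B where "B = (\<lambda>(q, r). {x. \<exists>s. s \<in> {q..r} \<and> (s, x) \<in> {z. \<Phi> (snd z) (\<sigma> * fst z) \<in> - \<Omega>}})"
  have "closed (B (q, r))" for q r
  proof -
    have "closed ((\<lambda>z. (\<lambda>(x, t). \<Phi> x t) (snd z, \<sigma> * fst z)) -` (- \<Omega>))"
      by (intro closed_vimage continuous_on_compose2[OF flow_continuous])
        (use assms in \<open>auto intro!: continuous_intros\<close>)
    then have "closed {z. \<Phi> (snd z) (\<sigma> * fst z) \<in> - \<Omega>}" by (simp add: vimage_def)
    then show ?thesis
      unfolding B_def prod.case by (rule closed_compact_projection[rotated]) simp
  qed
  moreover have countable: "countable {(q, r). q \<in> \<rat> \<and> r \<in> \<rat> \<and> 0 < q \<and> ereal r < c}"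
    by (rule countable_subset[of _ "\<rat> \<times> \<rat>"]) (auto simp: countable_rat)
  ultimately have "(\<Union>z\<in>{(q, r). q \<in> \<rat> \<and> r \<in> \<rat> \<and> 0 < q \<and> ereal r < c}. B z) \<in> sets borel"
    by (intro sets.countable_UN'' borel_closed) (use countable in auto)
  also have "(\<Union>z\<in>{(q, r). q \<in> \<rat> \<and> r \<in> \<rat> \<and> 0 < q \<and> ereal r < c}. B z)
      = {x \<in> space borel. exit_time \<Phi> \<Omega> \<sigma> x < c}" (is "?U = ?V")
  proof (intro set_eqI iffI)
    fix x assume "x \<in> ?U"
    then obtain q r s where "0 < q" "ereal r < c" "q \<le> s" "s \<le> r" "\<Phi> x (\<sigma> * s) \<notin> \<Omega>"
      by (auto simp: B_def)
    then have "exit_time \<Phi> \<Omega> \<sigma> x \<le> ereal s" "ereal s \<le> ereal r" "ereal r < c"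
      by (auto intro: exit_time_le)
    then have "exit_time \<Phi> \<Omega> \<sigma> x < c"
      using order_trans le_less_trans by blast
    then show "x \<in> ?V" by simp
  next
    fix x assume "x \<in> ?V"
    then obtain s where s: "0 < s" "ereal s < c" "\<Phi> x (\<sigma> * s) \<notin> \<Omega>"
      using le_exit_time_iff[of c \<Phi> \<Omega> \<sigma> x] by (auto simp: not_le)
    obtain q where q: "q \<in> \<rat>" "0 < q" "q < s"
      using Rats_dense_in_real[OF s(1)] by auto
    obtain r' where r': "ereal s < ereal r'" "ereal r' < c"
      using ereal_dense2[OF s(2)] by auto
    obtain r where r: "r \<in> \<rat>" "s < r" "r < r'"
      using Rats_dense_in_real[of s r'] r' by auto
    have "ereal r < ereal r'" using r by simp
    then have "ereal r < c" using r'(2) by (rule less_trans)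
    then have "(q, r) \<in> {(q, r). q \<in> \<rat> \<and> r \<in> \<rat> \<and> 0 < q \<and> ereal r < c}" "x \<in> B (q, r)"
      using q r s by (auto simp: B_def intro!: exI[of _ s])
    then show "x \<in> ?U" by blast
  qed
  finally show "{x \<in> space borel. exit_time \<Phi> \<Omega> \<sigma> x < c} \<in> sets borel" .
qed

text \<open>The length of the curve ending at \<open>y\<close> is the backward exit time of \<open>y\<close> itself. This description
  does not mention the interior point from which \<open>y\<close> is reached, which is why the definite
  description in the definition of the length denotes.\<close>

lemma
  assumes \<Omega>: "open \<Omega>" and y: "y \<in> flow_boundary \<Phi> \<Omega> 1"
  shows flow_boundary_notin: "y \<notin> \<Omega>"
    and curve_length_eq_exit_time: "curve_length \<Phi> \<Omega> 1 y = exit_time \<Phi> \<Omega> (-1) y"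
proof -
  show "y \<notin> \<Omega>"
    using y \<Omega> by (auto simp: flow_boundary_def frontier_def interior_open)
  have *: "exit_time \<Phi> \<Omega> (-1) y = exit_time \<Phi> \<Omega> (-1) x + exit_time \<Phi> \<Omega> 1 x"
    if x: "x \<in> \<Omega>" "exit_time \<Phi> \<Omega> 1 x < \<infinity>" "y = \<Phi> x (1 * real_of_ereal (exit_time \<Phi> \<Omega> 1 x))" for x
  proof -
    define p where "p = real_of_ereal (exit_time \<Phi> \<Omega> 1 x)"
    have p: "exit_time \<Phi> \<Omega> 1 x = ereal p" "0 \<le> p"
      using x(2) exit_time_nonneg[of \<Phi> \<Omega> 1 x]
      unfolding p_def by (cases "exit_time \<Phi> \<Omega> 1 x"; simp)+
    have yp: "y = \<Phi> x p" using x by (simp add: p_def)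
    have "\<Phi> y (-1 * r) \<in> \<Omega>" if "0 < r" "r \<le> p" for r
      using before_exit_time[of "p - r" \<Phi> \<Omega> 1 x] that p x
      by (cases "r = p") (auto simp: yp flow_flow flow_zero)
    from exit_time_after[OF p(2), of y "-1" \<Omega>, OF this]
    show ?thesis
      by (simp add: p(1)) (simp add: yp flow_flow flow_zero add.commute)
  qed
  obtain x where x: "x \<in> \<Omega>" "exit_time \<Phi> \<Omega> 1 x < \<infinity>" "y = \<Phi> x (1 * real_of_ereal (exit_time \<Phi> \<Omega> 1 x))"
    using y by (auto simp: flow_boundary_def)
  show "curve_length \<Phi> \<Omega> 1 y = exit_time \<Phi> \<Omega> (-1) y"
    unfolding curve_length_def
  proof (rule the_equality)
    show "\<exists>x\<in>\<Omega>. exit_time \<Phi> \<Omega> 1 x < \<infinity> \<and>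
        y = \<Phi> x (1 * real_of_ereal (exit_time \<Phi> \<Omega> 1 x)) \<and>
        exit_time \<Phi> \<Omega> (-1) y = exit_time \<Phi> \<Omega> (-1) x + exit_time \<Phi> \<Omega> 1 x"
      by (rule bexI[OF _ x(1)], intro conjI x(2,3) *[OF x])
  next
    fix l
    assume "\<exists>x\<in>\<Omega>. exit_time \<Phi> \<Omega> 1 x < \<infinity> \<and>
        y = \<Phi> x (1 * real_of_ereal (exit_time \<Phi> \<Omega> 1 x)) \<and>
        l = exit_time \<Phi> \<Omega> (-1) x + exit_time \<Phi> \<Omega> 1 x"
    then obtain x where "x \<in> \<Omega>" "exit_time \<Phi> \<Omega> 1 x < \<infinity>"
        "y = \<Phi> x (1 * real_of_ereal (exit_time \<Phi> \<Omega> 1 x))"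
      and l: "l = exit_time \<Phi> \<Omega> (-1) x + exit_time \<Phi> \<Omega> 1 x"
      by blast
    from *[OF this(1-3)] l show "l = exit_time \<Phi> \<Omega> (-1) y" by simp
  qed
qed

text \<open>The coordinates \<open>(y, s)\<close> of an interior point \<open>\<Phi> y (- s)\<close>: the second one is its exit time, and
  whether its backward exit time is infinite depends on \<open>y\<close> only.\<close>

lemma
  assumes \<Omega>: "open \<Omega>" and y: "y \<in> flow_boundary \<Phi> \<Omega> 1"
    and s: "0 < s" "ereal s < curve_length \<Phi> \<Omega> 1 y"
  shows boundary_curve_inside: "\<Phi> y (- s) \<in> \<Omega>"
    and exit_time_boundary_curve: "exit_time \<Phi> \<Omega> 1 (\<Phi> y (- s)) = ereal s"
    and backward_exit_time_boundary_curve: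
      "exit_time \<Phi> \<Omega> (-1) (\<Phi> y (- s)) = \<infinity> \<longleftrightarrow> curve_length \<Phi> \<Omega> 1 y = \<infinity>"
proof -
  have inside: "\<Phi> y (- r) \<in> \<Omega>" if "0 < r" "r \<le> s" for r
  proof -
    have "ereal r < curve_length \<Phi> \<Omega> 1 y"
      using that s(2) by (intro le_less_trans[of "ereal r" "ereal s"]) auto
    then show ?thesis
      using before_exit_time[of r \<Phi> \<Omega> "-1" y] that by (simp add: curve_length_eq_exit_time[OF \<Omega> y])
  qed
  then show "\<Phi> y (- s) \<in> \<Omega>" using s by simp
  show "exit_time \<Phi> \<Omega> 1 (\<Phi> y (- s)) = ereal s"
  proof (rule antisym)
    show "exit_time \<Phi> \<Omega> 1 (\<Phi> y (- s)) \<le> ereal s"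
      using s flow_boundary_notin[OF \<Omega> y] by (intro exit_time_le) (auto simp: flow_flow flow_zero)
    show "ereal s \<le> exit_time \<Phi> \<Omega> 1 (\<Phi> y (- s))"
      using inside[of "s - _"] by (auto simp: le_exit_time_iff flow_flow)
  qed
  have "exit_time \<Phi> \<Omega> (-1) y = ereal s + exit_time \<Phi> \<Omega> (-1) (\<Phi> y (- s))"
    using exit_time_after[of s y "-1" \<Omega>] inside s by simp
  then show "exit_time \<Phi> \<Omega> (-1) (\<Phi> y (- s)) = \<infinity> \<longleftrightarrow> curve_length \<Phi> \<Omega> 1 y = \<infinity>"
    by (cases "exit_time \<Phi> \<Omega> (-1) (\<Phi> y (- s))") (auto simp: curve_length_eq_exit_time[OF \<Omega> y])
qed

lemma exit_time_backward:
  assumes x: "x \<in> \<Omega>" and s: "0 \<le> s" "ereal s < exit_time \<Phi> \<Omega> (-1) x"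
  shows "exit_time \<Phi> \<Omega> 1 (\<Phi> x (- s)) = ereal s + exit_time \<Phi> \<Omega> 1 x"
proof -
  have "\<Phi> (\<Phi> x (- s)) (1 * r) \<in> \<Omega>" if "0 < r" "r \<le> s" for r
  proof (cases "r = s")
    case False
    have "ereal (s - r) < exit_time \<Phi> \<Omega> (-1) x"
      using that s(2) by (intro le_less_trans[of "ereal (s - r)" "ereal s"]) auto
    then show ?thesis
      using before_exit_time[of "s - r" \<Phi> \<Omega> "-1" x] that False by (simp add: flow_flow)
  qed (use x in \<open>simp add: flow_flow flow_zero\<close>)
  from exit_time_after[OF s(1), of "\<Phi> x (- s)" 1 \<Omega>, OF this] show ?thesis
    by (simp add: flow_flow flow_zero)
qed

end

section \<open>Radon measures\<close>

lemma radon_measure_sigma_finite: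
  fixes \<mu> :: "(real ^ 'n) measure"
  assumes "radon_measure \<mu>"
  shows "sigma_finite_measure \<mu>"
proof
  have "space \<mu> = UNIV" "\<And>K. compact K \<Longrightarrow> K \<in> sets \<mu>"
    using assms by (auto simp: radon_measure_def borel_compact dest: sets_eq_imp_space_eq)
  moreover have "emeasure \<mu> K \<noteq> \<infinity>" if "compact K" for K
    using assms that by (auto simp: radon_measure_def)
  moreover have "(\<Union>n::nat. cball (0 :: real ^ 'n) (real n)) = UNIV"
    using real_arch_simple by auto
  ultimately show "\<exists>A. countable A \<and> A \<subseteq> sets \<mu> \<and> \<Union> A = space \<mu> \<and> (\<forall>a\<in>A. emeasure \<mu> a \<noteq> \<infinity>)"
    by (intro exI[of _ "range (\<lambda>n::nat. cball 0 (real n))"]) auto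
qed

lemma radon_measure_borel_measurable:
  assumes "radon_measure \<mu>" "g \<in> borel_measurable borel"
  shows "g \<in> borel_measurable \<mu>"
proof -
  obtain \<nu> where \<nu>: "sets \<nu> = sets borel" "\<mu> = \<nu> \<or> \<mu> = completion \<nu>"
    using assms(1) by (auto simp: radon_measure_def)
  then have "g \<in> borel_measurable \<nu>" using assms(2) by (simp cong: measurable_cong_sets)
  then show ?thesis using \<nu>(2) by (auto intro: measurable_completion)
qed

section \<open>Time reversal\<close>

lemma distr_lebesgue_reflect: "distr lebesgue lebesgue (\<lambda>t. T - t :: real) = lebesgue"
proof -
  have "density (distr lebesgue lebesgue (\<lambda>t. T + - 1 * t)) (\<lambda>_. ennreal \<bar>- 1\<bar>) = lebesgue"
    by (rule lebesgue_real_affine[symmetric]) simp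
  then show ?thesis by (simp add: density_1)
qed

lemma measurable_lebesgue_reflect: "(\<lambda>t. T - t :: real) \<in> lebesgue \<rightarrow>\<^sub>M lebesgue"
  using lebesgue_affine_measurable[where c="\<lambda>_. - 1 :: real" and t=T]
  by (simp add: euclidean_representation_sum_fun Basis_real_def)

lemma AE_lebesgue_reflect:
  fixes T :: real
  assumes "AE t in lebesgue. P t"
  shows "AE t in lebesgue. P (T - t)"
  by (rule AE_distrD[OF measurable_lebesgue_reflect, where P=P])
     (unfold distr_lebesgue_reflect, rule assms)

lemma distr_pair_reflect:
  fixes T :: real
  shows "distr (M \<Otimes>\<^sub>M lborel) (M \<Otimes>\<^sub>M lborel) (\<lambda>(x, t). (x, T - t)) = M \<Otimes>\<^sub>M lborel"
proof -
  have reflect: "distr lborel lborel (\<lambda>t. T - t) = lborel"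
  proof -
    have "density (distr lborel borel (\<lambda>t. T + - 1 * t)) (\<lambda>_. ennreal \<bar>- 1\<bar>) = lborel"
      by (rule lborel_real_affine[symmetric]) simp
    then show ?thesis by (simp add: density_1 cong: distr_cong)
  qed
  have "distr M M (\<lambda>x. x) \<Otimes>\<^sub>M distr lborel lborel (\<lambda>t. T - t) =
      distr (M \<Otimes>\<^sub>M lborel) (M \<Otimes>\<^sub>M lborel) (\<lambda>(x, t). (x, T - t))"
    by (rule pair_measure_distr) (simp_all add: reflect lborel.sigma_finite_measure_axioms)
  then show ?thesis by (simp add: reflect)
qed

text \<open>Reversing the flow exchanges the two boundaries, and the reflection \<open>t \<mapsto> T - t\<close> of the test
  function turns one defining formula into the other. Hence only the outgoing boundary has
  to be treated.\<close>

lemma incoming_imp_outgoing_reverse: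
  assumes "incoming_boundary_measure \<mu> \<Phi> \<Omega> M"
  shows "outgoing_boundary_measure \<mu> (\<lambda>x t. \<Phi> x (- t)) \<Omega> M"
proof -
  define \<Gamma> where "\<Gamma> = flow_boundary \<Phi> \<Omega> (-1)"
  define \<tau>\<Gamma> where "\<tau>\<Gamma> = curve_length \<Phi> \<Omega> (-1)"
  define \<tau> where "\<tau> = exit_time \<Phi> \<Omega> 1"
  have sets_M: "sets M = sets (restrict_space borel \<Gamma>)"
    using assms by (simp add: incoming_boundary_measure_def Let_def \<Gamma>_def)
  have rev: "flow_boundary (\<lambda>x t. \<Phi> x (- t)) \<Omega> 1 = \<Gamma>"
    "curve_length (\<lambda>x t. \<Phi> x (- t)) \<Omega> 1 = \<tau>\<Gamma>"
    "exit_time (\<lambda>x t. \<Phi> x (- t)) \<Omega> (-1) = \<tau>"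
    by (auto simp: flow_boundary_reverse curve_length_reverse exit_time_def \<Gamma>_def \<tau>\<Gamma>_def \<tau>_def)
  have "(AE t in lebesgue. t \<in> {0<..<T} \<longrightarrow>
             iterated_integrable (completion M) \<Gamma> (\<lambda>y. min (\<tau>\<Gamma> y) (ereal t))
               (\<lambda>y s. f (\<Phi> y s, t - s))) \<and>
          set_integrable lebesgue {0<..<T}
            (\<lambda>t. LINT y:\<Gamma>|completion M.
               LINT s=0..min (\<tau>\<Gamma> y) (ereal t)|lebesgue. f (\<Phi> y s, t - s)) \<and>
          iterated_integrable \<mu> \<Omega> (\<lambda>x. min (\<tau> x) (ereal T)) (\<lambda>x s. f (\<Phi> x s, T - s)) \<and>
          (LINT z:\<Omega> \<times> {0<..<T}|\<mu> \<Otimes>\<^sub>M lborel. f z) =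
            (LINT t:{0<..<T}|lebesgue. LINT y:\<Gamma>|completion M.
               LINT s=0..min (\<tau>\<Gamma> y) (ereal t)|lebesgue. f (\<Phi> y s, t - s)) +
            (LINT x:\<Omega>|\<mu>. LINT s=0..min (\<tau> x) (ereal T)|lebesgue. f (\<Phi> x s, T - s))"
    if T: "T > 0" and f: "set_integrable (\<mu> \<Otimes>\<^sub>M lborel) (\<Omega> \<times> {0<..<T}) f"
    for T :: real and f :: "(real ^ 'a) \<times> real \<Rightarrow> real"
  proof -
    define R where "R = (\<lambda>(x :: real ^ 'a, t). (x, T - t))"
    have R[measurable]: "R \<in> \<mu> \<Otimes>\<^sub>M lborel \<rightarrow>\<^sub>M \<mu> \<Otimes>\<^sub>M lborel"
      unfolding R_def by measurable
    have distr_R: "distr (\<mu> \<Otimes>\<^sub>M lborel) (\<mu> \<Otimes>\<^sub>M lborel) R = \<mu> \<Otimes>\<^sub>M lborel"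
      unfolding R_def by (rule distr_pair_reflect)
    let ?h = "\<lambda>z. indicat_real (\<Omega> \<times> {0<..<T}) z * f z"
    have hR: "?h (R z) = indicat_real (\<Omega> \<times> {0<..<T}) z * f (R z)" for z
      by (cases z) (auto simp: R_def indicator_def)
    have h: "integrable (\<mu> \<Otimes>\<^sub>M lborel) ?h"
      using f by (simp add: set_integrable_def)
    note h_meas = borel_measurable_integrable[OF h]
    have "integrable (\<mu> \<Otimes>\<^sub>M lborel) (\<lambda>z. ?h (R z))"
      using h integrable_distr_eq[OF R h_meas] by (simp add: distr_R)
    then have fR: "set_integrable (\<mu> \<Otimes>\<^sub>M lborel) (\<Omega> \<times> {0<..<T}) (\<lambda>z. f (R z))"
      by (simp add: set_integrable_def hR)
    have int_fR: "(LINT z:\<Omega> \<times> {0<..<T}|\<mu> \<Otimes>\<^sub>M lborel. f (R z)) =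
        (LINT z:\<Omega> \<times> {0<..<T}|\<mu> \<Otimes>\<^sub>M lborel. f z)"
      using integral_distr[OF R h_meas] by (simp add: set_lebesgue_integral_def distr_R hR)
    have R_apply: "f (R (x, t + s)) = f (x, T - t - s)" for x t s
      by (simp add: R_def diff_diff_eq)
    define J where "J = (\<lambda>t. LINT y:\<Gamma>|completion M.
               LINT s=0..min (\<tau>\<Gamma> y) (ereal t)|lebesgue. f (\<Phi> y s, t - s))"
    have in_f: "(AE t in lebesgue. t \<in> {0<..<T} \<longrightarrow>
             iterated_integrable (completion M) \<Gamma> (\<lambda>y. min (\<tau>\<Gamma> y) (ereal (T - t)))
               (\<lambda>y s. f (\<Phi> y s, T - t - s)))"
      "set_integrable lebesgue {0<..<T} (\<lambda>t. J (T - t))"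
      "iterated_integrable \<mu> \<Omega> (\<lambda>x. min (\<tau> x) (ereal T)) (\<lambda>x s. f (\<Phi> x s, T - s))"
      "(LINT z:\<Omega> \<times> {0<..<T}|\<mu> \<Otimes>\<^sub>M lborel. f z) =
            (LINT t:{0<..<T}|lebesgue. J (T - t)) +
            (LINT x:\<Omega>|\<mu>. LINT s=0..min (\<tau> x) (ereal T)|lebesgue. f (\<Phi> x s, T - s))"
      using assms[unfolded incoming_boundary_measure_def Let_def, folded \<Gamma>_def \<tau>\<Gamma>_def \<tau>_def,
          THEN conjunct2, rule_format, OF T fR] int_fR R_apply R_apply[of _ 0]
      by (simp_all add: J_def)
    have ind: "indicator {0<..<T} (T - t) = (indicator {0<..<T} t :: real)" for t
      by (auto simp: indicator_def)
    have "integrable lebesgue (\<lambda>t. indicator {0<..<T} (T - t) *\<^sub>R J (T - t))"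
      using in_f(2) by (simp add: set_integrable_def ind)
    then have J: "set_integrable lebesgue {0<..<T} J"
      using lebesgue_integrable_real_affine_iff[of "-1" "\<lambda>t. indicator {0<..<T} t *\<^sub>R J t" T]
      by (simp add: set_integrable_def)
    have int_J: "(LINT t:{0<..<T}|lebesgue. J (T - t)) = (LINT t:{0<..<T}|lebesgue. J t)"
      using lebesgue_integral_real_affine[of "-1" "\<lambda>t. indicator {0<..<T} t *\<^sub>R J t" T]
      by (simp add: set_lebesgue_integral_def ind)
    have "AE t in lebesgue. t \<in> {0<..<T} \<longrightarrow>
             iterated_integrable (completion M) \<Gamma> (\<lambda>y. min (\<tau>\<Gamma> y) (ereal t))
               (\<lambda>y s. f (\<Phi> y s, t - s))"
      using AE_lebesgue_reflect[OF in_f(1), where T=T] by (simp add: conj_commute)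
    then show ?thesis
      using J in_f(3,4) int_J by (simp add: J_def)
  qed
  then show ?thesis
    unfolding outgoing_boundary_measure_def Let_def rev using sets_M by simp
qed

section \<open>Exhausting an iterated integral\<close>

lemma (in complete_measure) borel_measurable_AE_eq:
  fixes f g :: "'a \<Rightarrow> 'b::topological_space"
  assumes g: "g \<in> borel_measurable M" and eq: "AE x in M. f x = g x"
  shows "f \<in> borel_measurable M"
proof (rule measurableI)
  fix A :: "'b set" assume "A \<in> sets borel"
  with g have sets: "g -` A \<inter> space M \<in> sets M" by (rule measurable_sets)
  have "AE x in M. x \<in> g -` A \<inter> space M \<longleftrightarrow> x \<in> f -` A \<inter> space M"
    using eq by eventually_elim auto
  from in_sets_AE[OF this sets] show "f -` A \<inter> space M \<in> sets M" by simp
qed simp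

lemma interval_integral_eq_einterval:
  assumes "0 \<le> b"
  shows "(LINT s=0..b|lebesgue. h s) = (LINT s:einterval 0 b|lebesgue. h s)"
    and "interval_lebesgue_integrable lebesgue 0 b h \<longleftrightarrow> set_integrable lebesgue (einterval 0 b) h"
  using assms by (auto simp: interval_lebesgue_integral_def interval_lebesgue_integrable_def)

lemma einterval_exhaust:
  shows "incseq (\<lambda>n. einterval 0 (min b (ereal (real n))))"
    and "(\<Union>n. einterval 0 (min b (ereal (real n)))) = einterval 0 b"
proof -
  show "incseq (\<lambda>n. einterval 0 (min b (ereal (real n))))"
  proof (rule monoI, rule subsetI)
    fix m n :: nat and s assume "m \<le> n" and s: "s \<in> einterval 0 (min b (ereal (real m)))"
    then have "s < real m" "m \<le> n" by (auto simp: einterval_iff)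
    then have "s < real n" by linarith
    then show "s \<in> einterval 0 (min b (ereal (real n)))" using s by (auto simp: einterval_iff)
  qed
  show "(\<Union>n. einterval 0 (min b (ereal (real n)))) = einterval 0 b"
  proof (intro set_eqI iffI)
    fix s assume s: "s \<in> einterval 0 b"
    obtain n :: nat where "s < real n" using reals_Archimedean2 by blast
    with s show "s \<in> (\<Union>n. einterval 0 (min b (ereal (real n))))"
      by (auto simp: einterval_iff)
  qed (auto simp: einterval_iff)
qed

text \<open>Integrability on every truncated interval gives measurability of the limit, and monotone
  convergence turns the bound on the absolute integrals into integrability.\<close>

lemma set_integrable_exhaust:
  fixes h :: "real \<Rightarrow> real"
  assumes b: "0 \<le> b"
    and int: "\<And>n. set_integrable lebesgue (einterval 0 (min b (ereal (real n)))) h"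
    and bound: "(SUP n. ennreal (LINT s:einterval 0 (min b (ereal (real n)))|lebesgue. \<bar>h s\<bar>)) \<noteq> \<infinity>"
  shows "set_integrable lebesgue (einterval 0 b) h"
proof -
  define E where "E = (\<lambda>n. einterval 0 (min b (ereal (real n))))"
  have E: "incseq E" "(\<Union>n. E n) = einterval 0 b"
    unfolding E_def by (rule einterval_exhaust)+
  have E_meas: "(\<lambda>s. indicator (E n) s *\<^sub>R h s) \<in> borel_measurable lebesgue" for n
    using int[of n] by (auto simp: E_def set_integrable_def)
  have lim: "(\<lambda>n. indicator (E n) s *\<^sub>R h s) \<longlonglongrightarrow> indicator (einterval 0 b) s *\<^sub>R h s" for s
    using LIMSEQ_indicator_incseq[OF E(1), of s] by (intro tendsto_intros) (simp add: E(2))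
  have meas: "(\<lambda>s. indicator (einterval 0 b) s *\<^sub>R h s) \<in> borel_measurable lebesgue"
    by (rule borel_measurable_LIMSEQ_real[OF lim]) (rule E_meas)
  have "(\<integral>\<^sup>+s. ennreal (norm (indicator (einterval 0 b) s *\<^sub>R h s)) \<partial>lebesgue) =
     (SUP n. \<integral>\<^sup>+s. ennreal (norm (indicator (E n) s *\<^sub>R h s)) \<partial>lebesgue)"
  proof (subst nn_integral_monotone_convergence_SUP[symmetric])
    show "incseq (\<lambda>n s. ennreal (norm (indicator (E n) s *\<^sub>R h s)))"
      using E(1) by (auto simp: incseq_def le_fun_def indicator_def split: if_splits)
    then show "(\<integral>\<^sup>+s. ennreal (norm (indicator (einterval 0 b) s *\<^sub>R h s)) \<partial>lebesgue) =
      (\<integral>\<^sup>+s. (SUP n. ennreal (norm (indicator (E n) s *\<^sub>R h s))) \<partial>lebesgue)"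
      by (intro nn_integral_cong LIMSEQ_unique[OF _ LIMSEQ_SUP] tendsto_ennrealI tendsto_norm lim)
        (auto simp: incseq_def le_fun_def)
    show "(\<lambda>s. ennreal (norm (indicator (E n) s *\<^sub>R h s))) \<in> borel_measurable lebesgue" for n
      by (rule measurable_compose[OF measurable_compose[OF E_meas borel_measurable_norm] measurable_ennreal])
  qed
  also have "\<dots> = (SUP n. ennreal (LINT s:E n|lebesgue. \<bar>h s\<bar>))"
  proof (intro SUP_cong refl)
    fix n
    have "integrable lebesgue (\<lambda>s. indicator (E n) s *\<^sub>R \<bar>h s\<bar>)"
      using set_integrable_abs[OF int[of n]] by (simp add: set_integrable_def E_def)
    then have "(\<integral>\<^sup>+s. ennreal (indicator (E n) s *\<^sub>R \<bar>h s\<bar>) \<partial>lebesgue) = ennreal (LINT s:E n|lebesgue. \<bar>h s\<bar>)"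
      unfolding set_lebesgue_integral_def by (rule nn_integral_eq_integral) simp
    then show "(\<integral>\<^sup>+s. ennreal (norm (indicator (E n) s *\<^sub>R h s)) \<partial>lebesgue) = ennreal (LINT s:E n|lebesgue. \<bar>h s\<bar>)"
      by (simp add: abs_mult)
  qed
  also have "\<dots> < \<infinity>"
    using bound unfolding E_def infinity_ennreal_def less_top .
  finally show ?thesis
    using meas by (simp add: set_integrable_def integrable_iff_bounded)
qed

text \<open>The supremum \<open>D\<close> of the truncated inner integrals of \<open>\<bar>g\<bar>\<close> has a finite integral by monotone
  convergence. It is therefore finite almost everywhere, which gives integrability of the
  untruncated inner integrals, and it dominates the truncated inner integrals of \<open>g\<close>. The outer
  measure has to be complete because the untruncated inner integral is known to be the limit of
  measurable functions only almost everywhere.\<close>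

lemma iterated_integrable_exhaust:
  fixes M :: "'a measure" and b :: "'a \<Rightarrow> ereal" and g :: "'a \<Rightarrow> real \<Rightarrow> real"
  assumes M: "complete_measure M"
    and b: "\<And>y. 0 \<le> b y"
    and g: "\<And>n::nat. iterated_integrable M A (\<lambda>y. min (b y) (ereal n)) g"
    and abs_g: "\<And>n::nat. iterated_integrable M A (\<lambda>y. min (b y) (ereal n)) (\<lambda>y s. \<bar>g y s\<bar>)"
    and bound: "\<And>n::nat. (LINT y:A|M. LINT s=0..min (b y) (ereal n)|lebesgue. \<bar>g y s\<bar>) \<le> C"
  shows "iterated_integrable M A b g"
    and "(\<lambda>n::nat. LINT y:A|M. LINT s=0..min (b y) (ereal n)|lebesgue. g y s)
       \<longlonglongrightarrow> (LINT y:A|M. LINT s=0..b y|lebesgue. g y s)"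
proof -
  interpret complete_measure M by (rule M)
  define E where "E = (\<lambda>y (n::nat). einterval 0 (min (b y) (ereal n)))"
  define G where "G = (\<lambda>(n::nat) y. indicator A y *\<^sub>R (LINT s:E y n|lebesgue. g y s))"
  define G' where "G' = (\<lambda>(n::nat) y. indicator A y *\<^sub>R (LINT s:E y n|lebesgue. \<bar>g y s\<bar>))"
  define H where "H = (\<lambda>y. indicator A y *\<^sub>R (LINT s:einterval 0 (b y)|lebesgue. g y s))"
  define D where "D = (\<lambda>y. SUP n. ennreal (G' n y))"
  have min_b: "0 \<le> min (b y) (ereal (real n))" for y n using b by simp
  note interval = interval_integral_eq_einterval[OF min_b] interval_integral_eq_einterval[OF b]
  have int_G: "integrable M (G n)" and int_G': "integrable M (G' n)" for n
    using g[of n] abs_g[of n]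
    by (simp_all add: iterated_integrable_def set_integrable_def G_def G'_def E_def interval)
  have G'_nonneg: "0 \<le> G' n y" for n y
    by (auto simp: G'_def set_lebesgue_integral_def intro!: mult_nonneg_nonneg integral_nonneg)
  have inner: "AE y in M. \<forall>n. y \<in> A \<longrightarrow> set_integrable lebesgue (E y n) (g y)"
    unfolding AE_all_countable
    using g by (simp add: iterated_integrable_def E_def interval)
  have D_meas[measurable]: "D \<in> borel_measurable M"
    unfolding D_def using int_G' by measurable
  have "(\<integral>\<^sup>+y. D y \<partial>M) = (SUP n. \<integral>\<^sup>+y. ennreal (G' n y) \<partial>M)"
    unfolding D_def
  proof (rule nn_integral_monotone_convergence_SUP_AE)
    fix n
    show "AE y in M. ennreal (G' n y) \<le> ennreal (G' (Suc n) y)"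
      using inner
    proof eventually_elim
      case (elim y)
      have sub: "E y n \<subseteq> E y (Suc n)"
        using einterval_exhaust(1)[of "b y"] by (auto simp: E_def incseq_Suc_iff)
      have "(LINT s:E y n|lebesgue. \<bar>g y s\<bar>) \<le> (LINT s:E y (Suc n)|lebesgue. \<bar>g y s\<bar>)" if "y \<in> A"
      proof -
        have "integrable lebesgue (\<lambda>s. indicator (E y k) s *\<^sub>R \<bar>g y s\<bar>)" for k
          using set_integrable_abs[of lebesgue "E y k" "g y"] elim that by (simp add: set_integrable_def)
        then show ?thesis
          unfolding set_lebesgue_integral_def
          by (intro integral_mono) (use sub in \<open>auto simp: indicator_def\<close>)
      qed
      then show ?case
        by (auto simp: G'_def indicator_def intro!: ennreal_leI)
    qed
    show "(\<lambda>y. ennreal (G' n y)) \<in> borel_measurable M" using int_G' by measurable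
  qed
  also have "\<dots> \<le> ennreal C"
  proof (rule SUP_least)
    fix n
    have "(\<integral>\<^sup>+y. ennreal (G' n y) \<partial>M) = ennreal (LINT y|M. G' n y)"
      using int_G' G'_nonneg by (intro nn_integral_eq_integral) auto
    also have "\<dots> \<le> ennreal C"
      using bound[of n] by (intro ennreal_leI) (simp add: G'_def E_def set_lebesgue_integral_def[of M] interval)
    finally show "(\<integral>\<^sup>+y. ennreal (G' n y) \<partial>M) \<le> ennreal C" .
  qed
  finally have "(\<integral>\<^sup>+y. D y \<partial>M) \<le> ennreal C" .
  from le_less_trans[OF this ennreal_less_top]
  have D_fin: "(\<integral>\<^sup>+y. D y \<partial>M) < \<infinity>"
    by simp
  then have D_AE: "AE y in M. D y \<noteq> \<infinity>"
    by (intro nn_integral_PInf_AE D_meas) simp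
  have int_D: "integrable M (\<lambda>y. enn2real (D y))"
  proof (rule integrableI_bounded)
    have "(\<integral>\<^sup>+y. ennreal (norm (enn2real (D y))) \<partial>M) \<le> (\<integral>\<^sup>+y. D y \<partial>M)"
      by (intro nn_integral_mono) (simp add: ennreal_enn2real_if)
    from le_less_trans[OF this D_fin]
    show "(\<integral>\<^sup>+y. ennreal (norm (enn2real (D y))) \<partial>M) < \<infinity>" .
    show "(\<lambda>y. enn2real (D y)) \<in> borel_measurable M" by measurable
  qed
  have full: "AE y in M. y \<in> A \<longrightarrow> set_integrable lebesgue (einterval 0 (b y)) (g y)"
    using inner D_AE
  proof eventually_elim
    case (elim y)
    show ?case
    proof
      assume y: "y \<in> A"
      then have "D y = (SUP n. ennreal (LINT s:einterval 0 (min (b y) (ereal (real n)))|lebesgue. \<bar>g y s\<bar>))"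
        by (simp add: D_def G'_def E_def)
      then show "set_integrable lebesgue (einterval 0 (b y)) (g y)"
        using elim y by (intro set_integrable_exhaust[OF b[of y]]) (simp_all add: E_def)
    qed
  qed
  have lim: "AE y in M. (\<lambda>n. G n y) \<longlonglongrightarrow> H y"
    using full
  proof eventually_elim
    case (elim y)
    have "(\<lambda>n. LINT s:E y n|lebesgue. g y s) \<longlonglongrightarrow> (LINT s:einterval 0 (b y)|lebesgue. g y s)" if "y \<in> A"
      using set_integral_cont_up[of "E y" lebesgue "g y"] einterval_exhaust[of "b y"] elim that
      by (simp add: E_def)
    then show ?case by (cases "y \<in> A") (auto simp: G_def H_def)
  qed
  have dom: "AE y in M. norm (G n y) \<le> enn2real (D y)" for n
    using D_AE inner
  proof eventually_elim
    case (elim y)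
    have "norm (G n y) \<le> G' n y"
      using elim set_integral_norm_bound[of lebesgue "E y n" "g y"] by (auto simp: G_def G'_def indicator_def)
    also have "\<dots> = enn2real (ennreal (G' n y))" using G'_nonneg by simp
    also have "\<dots> \<le> enn2real (D y)"
    proof (rule enn2real_mono)
      show "ennreal (G' n y) \<le> D y" unfolding D_def by (rule SUP_upper) simp
      show "D y < top" using elim(1) unfolding infinity_ennreal_def less_top .
    qed
    finally show ?case .
  qed
  have [measurable]: "G n \<in> borel_measurable M" for n using int_G by measurable
  have "AE y in M. H y = lim (\<lambda>n. G n y)"
    using lim by eventually_elim (simp add: limI)
  then have H_meas: "H \<in> borel_measurable M"
    by (rule borel_measurable_AE_eq[rotated]) measurable
  have "integrable M H"
    using H_meas _ int_D lim dom by (rule integrable_dominated_convergence) simp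
  then show "iterated_integrable M A b g"
    using full by (simp add: iterated_integrable_def set_integrable_def[of M] H_def interval)
  have "(\<lambda>n. LINT y|M. G n y) \<longlonglongrightarrow> (LINT y|M. H y)"
    using H_meas _ int_D lim dom by (rule integral_dominated_convergence) simp
  then show "(\<lambda>n::nat. LINT y:A|M. LINT s=0..min (b y) (ereal n)|lebesgue. g y s)
       \<longlonglongrightarrow> (LINT y:A|M. LINT s=0..b y|lebesgue. g y s)"
    by (simp add: set_lebesgue_integral_def[of M] G_def H_def E_def interval)
qed

text \<open>Only the values of the integrand on the region of integration matter, so that the outer
  set, the inner bound and the integrand may be changed at the same time.\<close>

lemma iterated_integral_cong:
  fixes g g' :: "'a \<Rightarrow> real \<Rightarrow> real"
  assumes nonneg: "\<And>y. y \<in> A \<Longrightarrow> 0 \<le> b y" "\<And>y. y \<in> A' \<Longrightarrow> 0 \<le> b' y"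
    and eq: "\<And>y s. indicat_real A y * (indicat_real (einterval 0 (b y)) s * g y s) =
      indicat_real A' y * (indicat_real (einterval 0 (b' y)) s * g' y s)"
  shows "iterated_integrable M A b g \<longleftrightarrow> iterated_integrable M A' b' g'"
    and "(LINT y:A|M. LINT s=0..b y|lebesgue. g y s) = (LINT y:A'|M. LINT s=0..b' y|lebesgue. g' y s)"
proof -
  have outer: "indicat_real A y * (LINT s=0..b y|lebesgue. g y s) =
      indicat_real A' y * (LINT s=0..b' y|lebesgue. g' y s)" for y
  proof -
    have "indicat_real A y * (LINT s=0..b y|lebesgue. g y s) =
        (LINT s|lebesgue. indicat_real A y * (indicat_real (einterval 0 (b y)) s * g y s))"
      using nonneg by (cases "y \<in> A") (simp_all add: interval_integral_eq_einterval set_lebesgue_integral_def)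
    also have "\<dots> = indicat_real A' y * (LINT s=0..b' y|lebesgue. g' y s)"
      unfolding eq
      using nonneg by (cases "y \<in> A'") (simp_all add: interval_integral_eq_einterval set_lebesgue_integral_def)
    finally show ?thesis .
  qed
  have inner: "(y \<in> A \<longrightarrow> interval_lebesgue_integrable lebesgue 0 (b y) (g y)) \<longleftrightarrow>
      (y \<in> A' \<longrightarrow> interval_lebesgue_integrable lebesgue 0 (b' y) (g' y))" for y
  proof -
    have "(y \<in> A \<longrightarrow> interval_lebesgue_integrable lebesgue 0 (b y) (g y)) \<longleftrightarrow>
        integrable lebesgue (\<lambda>s. indicat_real A y * (indicat_real (einterval 0 (b y)) s * g y s))"
      using nonneg by (cases "y \<in> A") (simp_all add: interval_integral_eq_einterval set_integrable_def)
    also have "\<dots> \<longleftrightarrow> (y \<in> A' \<longrightarrow> interval_lebesgue_integrable lebesgue 0 (b' y) (g' y))"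
      unfolding eq
      using nonneg by (cases "y \<in> A'") (simp_all add: interval_integral_eq_einterval set_integrable_def)
    finally show ?thesis .
  qed
  show "iterated_integrable M A b g \<longleftrightarrow> iterated_integrable M A' b' g'"
    unfolding iterated_integrable_def set_integrable_def[of M] inner real_scaleR_def outer ..
  show "(LINT y:A|M. LINT s=0..b y|lebesgue. g y s) = (LINT y:A'|M. LINT s=0..b' y|lebesgue. g' y s)"
    unfolding set_lebesgue_integral_def[of M] real_scaleR_def outer ..
qed

section \<open>Integration along the curves ending on the outgoing boundary\<close>

context continuous_flow
begin

lemma curve_length_nonneg:
  assumes "open \<Omega>" "y \<in> flow_boundary \<Phi> \<Omega> 1"
  shows "0 \<le> curve_length \<Phi> \<Omega> 1 y"
  using curve_length_eq_exit_time[OF assms] exit_time_nonneg by simp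

text \<open>A condition on \<open>t + p\<close> cuts out an interval of length one in \<open>t\<close> for every \<open>p < a\<close>; the
  restriction \<open>0 < t < a + 1\<close> then holds automatically.\<close>

lemma time_window_slice:
  fixes q a t :: real and p :: ereal
  assumes "0 \<le> p"
  shows "(p < ereal a \<and> ereal a < ereal t + p \<and> ereal t + p < ereal (a + 1) \<and> 0 < t \<and> t < a + 1) \<longleftrightarrow>
    (p < ereal a \<and> t \<in> {a - real_of_ereal p<..<a + 1 - real_of_ereal p})"
  using assms by (cases p) auto

text \<open>The heart of the proof. With \<open>p\<close> the exit time, take as test function \<open>f x\<close> restricted to
  \<open>p x < a < t + p x < a + 1\<close>, on the time interval \<open>(0, a + 1)\<close>. The quantity \<open>t + p x\<close>, the time at
  which a particle that is at \<open>x\<close> at time \<open>t\<close> leaves \<open>\<Omega>\<close>, is constant along trajectories. At the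
  points \<open>(\<Phi> y (- s), t - s)\<close> of the boundary term it equals \<open>t\<close>, so that this term is the right
  hand side below for \<open>a < t < a + 1\<close>, independently of \<open>t\<close>, and zero for smaller \<open>t\<close>. At the
  points \<open>(\<Phi> x (- s), a + 1 - s)\<close> of the terminal term it is at least \<open>a + 1\<close>, so that this term
  vanishes. The window has length one, and Fubini's theorem gives the left hand side.\<close>

lemma truncated_boundary_identity:
  assumes \<mu>: "radon_measure \<mu>" and \<Omega>: "open \<Omega>"
    and M: "outgoing_boundary_measure \<mu> \<Phi> \<Omega> M"
    and f: "set_integrable \<mu> \<Omega> f" and a: "0 \<le> a"
  defines "\<Gamma> \<equiv> flow_boundary \<Phi> \<Omega> 1" and "\<tau>\<Gamma> \<equiv> curve_length \<Phi> \<Omega> 1"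
  shows "iterated_integrable (completion M) \<Gamma> (\<lambda>y. min (\<tau>\<Gamma> y) (ereal a)) (\<lambda>y s. f (\<Phi> y (- s)))"
    and "(LINT x:{x \<in> \<Omega>. exit_time \<Phi> \<Omega> 1 x < ereal a}|\<mu>. f x) =
      (LINT y:\<Gamma>|completion M. LINT s=0..min (\<tau>\<Gamma> y) (ereal a)|lebesgue. f (\<Phi> y (- s)))"
proof -
  define p where "p = exit_time \<Phi> \<Omega> 1"
  define \<tau> where "\<tau> = exit_time \<Phi> \<Omega> (-1)"
  define T where "T = a + 1"
  define h where "h = (\<lambda>x. indicat_real \<Omega> x * f x)"
  define g where "g = (\<lambda>(x, t). if x \<in> \<Omega> \<and> p x < ereal a \<and> ereal a < ereal t + p x \<and> ereal t + p x < ereal T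
    then f x else 0)"
  define S where "S = (\<lambda>x. if p x < ereal a then {a - real_of_ereal (p x)<..<T - real_of_ereal (p x)} else {})"
  define k where "k = (\<lambda>z. indicat_real (\<Omega> \<times> {0<..<T}) z * g z)"
  define c where "c = (LINT y:\<Gamma>|completion M. LINT s=0..min (\<tau>\<Gamma> y) (ereal a)|lebesgue. f (\<Phi> y (- s)))"
  have T: "T > 0" using a by (simp add: T_def)
  have p_nonneg: "0 \<le> p x" for x unfolding p_def by (rule exit_time_nonneg)
  interpret \<mu>: sigma_finite_measure \<mu> by (rule radon_measure_sigma_finite[OF \<mu>])
  interpret pair_sigma_finite \<mu> lborel ..
  have p_meas[measurable]: "p \<in> borel_measurable \<mu>"
    unfolding p_def by (intro radon_measure_borel_measurable[OF \<mu>] borel_measurable_exit_time \<Omega>)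
  have h: "integrable \<mu> h" using f by (simp add: h_def set_integrable_def)
  have [measurable]: "h \<in> borel_measurable \<mu>" using h by measurable

  \<comment> \<open>the left hand side of the defining formula, by integrating over time first\<close>
  have k_slice: "k (x, t) = h x * indicat_real (S x) t" for x t
    using time_window_slice[OF p_nonneg, of x a t]
    by (auto simp: k_def g_def h_def S_def T_def indicator_def)
  have k_window: "k = (\<lambda>z. h (fst z) * of_bool (p (fst z) < ereal a \<and> ereal a < ereal (snd z) + p (fst z) \<and>
      ereal (snd z) + p (fst z) < ereal T \<and> 0 < snd z \<and> snd z < T))"
    by (auto simp: k_def g_def h_def indicator_def fun_eq_iff)
  have k_meas: "k \<in> borel_measurable (\<mu> \<Otimes>\<^sub>M lborel)"
    unfolding k_window by measurable
  have S_int: "integrable lborel (indicat_real (S x))"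
    and S_one: "measure lborel (S x) = of_bool (p x < ereal a)" for x
    by (auto simp: S_def T_def integrable_indicator_iff)
  have k_int: "integrable (\<mu> \<Otimes>\<^sub>M lborel) k"
  proof (rule Fubini_integrable[OF k_meas])
    have "integrable \<mu> (\<lambda>x. \<bar>h x\<bar> * of_bool (p x < ereal a))"
      by (rule Bochner_Integration.integrable_bound[OF h]) (auto simp: abs_mult)
    then show "integrable \<mu> (\<lambda>x. LINT t|lborel. norm (k (x, t)))"
      by (simp add: k_slice abs_mult S_one)
    show "AE x in \<mu>. integrable lborel (\<lambda>t. k (x, t))"
      using S_int by (simp add: k_slice)
  qed
  have "integral\<^sup>L (\<mu> \<Otimes>\<^sub>M lborel) k = (LINT x|\<mu>. LINT t|lborel. k (x, t))"
    using integral_fst'[OF k_int] by simp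
  also have "\<dots> = (LINT x:{x \<in> \<Omega>. p x < ereal a}|\<mu>. f x)"
  proof -
    have "(LINT t|lborel. k (x, t)) = indicat_real {x \<in> \<Omega>. p x < ereal a} x *\<^sub>R f x" for x
      by (simp add: k_slice S_one) (simp add: h_def indicator_def)
    then show ?thesis by (simp only: set_lebesgue_integral_def)
  qed
  finally have lhs: "(LINT z:\<Omega> \<times> {0<..<T}|\<mu> \<Otimes>\<^sub>M lborel. g z) = (LINT x:{x \<in> \<Omega>. p x < ereal a}|\<mu>. f x)"
    by (simp add: set_lebesgue_integral_def k_def)

  have g_int: "set_integrable (\<mu> \<Otimes>\<^sub>M lborel) (\<Omega> \<times> {0<..<T}) g"
    using k_int by (simp add: set_integrable_def k_def)
  define I where "I = (\<lambda>t. LINT y:\<Gamma>|completion M.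
      LINT s=0..min (\<tau>\<Gamma> y) (ereal t)|lebesgue. g (\<Phi> y (- s), t - s))"
  have good: "AE t in lebesgue. t \<in> {0<..<T} \<longrightarrow>
             iterated_integrable (completion M) \<Gamma> (\<lambda>y. min (\<tau>\<Gamma> y) (ereal t))
               (\<lambda>y s. g (\<Phi> y (- s), t - s))"
    and formula: "(LINT z:\<Omega> \<times> {0<..<T}|\<mu> \<Otimes>\<^sub>M lborel. g z) = (LINT t:{0<..<T}|lebesgue. I t) +
            (LINT x:\<Omega>|\<mu>. LINT s=0..min (\<tau> x) (ereal T)|lebesgue. g (\<Phi> x (- s), T - s))"
    using M[unfolded outgoing_boundary_measure_def Let_def, folded \<Gamma>_def \<tau>\<Gamma>_def \<tau>_def,
        THEN conjunct2, rule_format, OF T g_int] by (simp_all add: I_def)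

  have len: "0 \<le> min (\<tau>\<Gamma> y) (ereal t)" if "y \<in> \<Gamma>" "0 \<le> t" for y t
    using that curve_length_nonneg[OF \<Omega>] by (simp add: \<Gamma>_def \<tau>\<Gamma>_def)
  have curve: "\<Phi> y (- s) \<in> \<Omega>" "p (\<Phi> y (- s)) = ereal s"
    if "y \<in> \<Gamma>" "0 < s" "ereal s < \<tau>\<Gamma> y" for y s
    using boundary_curve_inside[OF \<Omega>] exit_time_boundary_curve[OF \<Omega>] that
    by (simp_all add: \<Gamma>_def \<tau>\<Gamma>_def p_def)
  \<comment> \<open>since \<open>t\<close> exceeds \<open>a\<close>, the condition \<open>p < a\<close> replaces the bound \<open>t\<close> on \<open>s\<close> by the bound \<open>a\<close>\<close>
  have late: "indicat_real \<Gamma> y * (indicat_real (einterval 0 (min (\<tau>\<Gamma> y) (ereal t))) s * g (\<Phi> y (- s), t - s)) =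
      indicat_real \<Gamma> y * (indicat_real (einterval 0 (min (\<tau>\<Gamma> y) (ereal a))) s * f (\<Phi> y (- s)))"
    if "a < t" "t < T" for y s t
    using that curve[of y s] by (auto simp: indicator_def einterval_iff g_def)
  have early: "indicat_real \<Gamma> y * (indicat_real (einterval 0 (min (\<tau>\<Gamma> y) (ereal t))) s * g (\<Phi> y (- s), t - s)) = 0"
    if "t \<le> a" for y s t
    using that curve[of y s] by (auto simp: indicator_def einterval_iff g_def)

  show "iterated_integrable (completion M) \<Gamma> (\<lambda>y. min (\<tau>\<Gamma> y) (ereal a)) (\<lambda>y s. f (\<Phi> y (- s)))"
  proof (rule ccontr)
    \<comment> \<open>the inner statement is given for almost every \<open>t\<close>, but on \<open>(a, a + 1)\<close> it does not depend on \<open>t\<close>\<close>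
    assume no: "\<not> ?thesis"
    have "AE t in lebesgue. t \<notin> {a<..<T}"
      using good
    proof eventually_elim
      case (elim t)
      show ?case
      proof
        assume t: "t \<in> {a<..<T}"
        then have "iterated_integrable (completion M) \<Gamma> (\<lambda>y. min (\<tau>\<Gamma> y) (ereal t))
               (\<lambda>y s. g (\<Phi> y (- s), t - s))"
          using elim a by simp
        then show False
          using no by (subst (asm) iterated_integral_cong(1)[OF len len late]) (use t a in auto)
      qed
    qed
    then have "emeasure lebesgue {a<..<T} = 0"
      by (subst (asm) AE_iff_measurable[OF _ refl]) (auto simp: greaterThanLessThan_def greaterThan_def lessThan_def Int_def)
    then show False by (simp add: T_def)
  qed

  have zero: "(LINT s=0..0|lebesgue. 0 :: real) = 0"
    by (simp add: interval_lebesgue_integral_def set_lebesgue_integral_def)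
  have I: "I t = indicat_real {a<..<T} t * c" if "t \<in> {0<..<T}" for t
  proof (cases "a < t")
    case True
    have "I t = c"
      unfolding I_def c_def
      by (rule iterated_integral_cong(2)[OF len len late]) (use True that a in auto)
    then show ?thesis using True that by simp
  next
    case False
    have "I t = (LINT y:\<Gamma>|completion M. LINT s=0..0|lebesgue. 0)"
      unfolding I_def using early[of t] False that
      by (intro iterated_integral_cong(2) len) auto
    then show ?thesis using False by (simp add: zero)
  qed
  have "(LINT t:{0<..<T}|lebesgue. I t) = (LINT t|lebesgue. indicat_real {a<..<T} t * c)"
    unfolding set_lebesgue_integral_def
    by (intro Bochner_Integration.integral_cong) (use a in \<open>auto simp: I indicator_def\<close>)
  also have "\<dots> = c" by (simp add: T_def)
  finally have int_I: "(LINT t:{0<..<T}|lebesgue. I t) = c" .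

  have "g (\<Phi> x (- s), T - s) = 0" if "x \<in> \<Omega>" "0 < s" "ereal s < \<tau> x" for x s
  proof -
    have "p (\<Phi> x (- s)) = ereal s + p x"
      using exit_time_backward[of x \<Omega> s] that by (simp add: p_def \<tau>_def)
    then show ?thesis using p_nonneg[of x] by (cases "p x") (auto simp: g_def)
  qed
  then have "(LINT x:\<Omega>|\<mu>. LINT s=0..min (\<tau> x) (ereal T)|lebesgue. g (\<Phi> x (- s), T - s)) =
      (LINT x:\<Omega>|\<mu>. LINT s=0..0|lebesgue. 0)"
    using T exit_time_nonneg
    by (intro iterated_integral_cong(2)) (auto simp: indicator_def einterval_iff \<tau>_def)
  then show "(LINT x:{x \<in> \<Omega>. exit_time \<Phi> \<Omega> 1 x < ereal a}|\<mu>. f x) =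
      (LINT y:\<Gamma>|completion M. LINT s=0..min (\<tau>\<Gamma> y) (ereal a)|lebesgue. f (\<Phi> y (- s)))"
    using formula lhs int_I by (simp add: p_def c_def zero)
qed

text \<open>Let \<open>a\<close> tend to infinity along the naturals. The absolute integrals that the limit requires
  to be bounded are, by the truncated identity for \<open>\<bar>f\<bar>\<close>, integrals of \<open>\<bar>f\<bar>\<close> over subsets of \<open>\<Omega>\<close>.\<close>

lemma outgoing_identity:
  assumes \<mu>: "radon_measure \<mu>" and \<Omega>: "open \<Omega>"
    and M: "outgoing_boundary_measure \<mu> \<Phi> \<Omega> M"
    and f: "set_integrable \<mu> \<Omega> f"
  defines "\<Gamma> \<equiv> flow_boundary \<Phi> \<Omega> 1" and "\<tau>\<Gamma> \<equiv> curve_length \<Phi> \<Omega> 1"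
  shows "iterated_integrable (completion M) \<Gamma> \<tau>\<Gamma> (\<lambda>y s. f (\<Phi> y (- s)))"
    and "(LINT x:finite_exit \<Phi> \<Omega> 1|\<mu>. f x) =
      (LINT y:\<Gamma>|completion M. LINT s=0..\<tau>\<Gamma> y|lebesgue. f (\<Phi> y (- s)))"
proof -
  define \<tau> where "\<tau> = exit_time \<Phi> \<Omega> (-1)"
  define A where "A = (\<lambda>n::nat. {x \<in> \<Omega>. exit_time \<Phi> \<Omega> 1 x < ereal (real n)})"
  have \<tau>: "\<tau>\<Gamma> y = \<tau> y" if "y \<in> \<Gamma>" for y
    using that curve_length_eq_exit_time[OF \<Omega>] by (simp add: \<Gamma>_def \<tau>\<Gamma>_def \<tau>_def)
  have \<tau>_nonneg: "0 \<le> \<tau> y" for y unfolding \<tau>_def by (rule exit_time_nonneg)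
  have truncate: "iterated_integrable (completion M) \<Gamma> (\<lambda>y. min (\<tau> y) (ereal (real n))) (\<lambda>y s. g (\<Phi> y (- s)))"
    "(LINT x:A n|\<mu>. g x) = (LINT y:\<Gamma>|completion M. LINT s=0..min (\<tau> y) (ereal (real n))|lebesgue. g (\<Phi> y (- s)))"
    if g: "set_integrable \<mu> \<Omega> g" for g n
  proof -
    have eq: "indicat_real \<Gamma> y * (indicat_real (einterval 0 (min (\<tau>\<Gamma> y) (ereal (real n)))) s * g (\<Phi> y (- s))) =
        indicat_real \<Gamma> y * (indicat_real (einterval 0 (min (\<tau> y) (ereal (real n)))) s * g (\<Phi> y (- s)))" for y s
      by (cases "y \<in> \<Gamma>") (simp_all add: \<tau>)
    note cong = iterated_integral_cong[OF _ _ eq, of "completion M"]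
    note trunc = truncated_boundary_identity[OF \<mu> \<Omega> M g, of "real n", folded \<Gamma>_def \<tau>\<Gamma>_def]
    show "iterated_integrable (completion M) \<Gamma> (\<lambda>y. min (\<tau> y) (ereal (real n))) (\<lambda>y s. g (\<Phi> y (- s)))"
      using trunc(1) cong(1) \<tau>_nonneg by (simp add: \<tau>)
    show "(LINT x:A n|\<mu>. g x) = (LINT y:\<Gamma>|completion M. LINT s=0..min (\<tau> y) (ereal (real n))|lebesgue. g (\<Phi> y (- s)))"
      using trunc(2) cong(2) \<tau>_nonneg by (simp add: A_def \<tau>)
  qed
  have [measurable]: "exit_time \<Phi> \<Omega> 1 \<in> borel_measurable \<mu>"
    by (intro radon_measure_borel_measurable[OF \<mu>] borel_measurable_exit_time \<Omega>)
  have \<mu>_sets: "\<Omega> \<in> sets \<mu>" and \<mu>_space: "space \<mu> = UNIV"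
    using \<mu> \<Omega> by (auto simp: radon_measure_def dest: sets_eq_imp_space_eq)
  have A_sets: "A n \<in> sets \<mu>" for n
  proof -
    have "A n = \<Omega> \<inter> {x \<in> space \<mu>. exit_time \<Phi> \<Omega> 1 x < ereal (real n)}"
      by (auto simp: A_def \<mu>_space)
    then show ?thesis using \<mu>_sets by simp
  qed
  have A_mono: "incseq A"
  proof (rule monoI, rule subsetI)
    fix m n :: nat and x assume "m \<le> n" "x \<in> A m"
    then have "x \<in> \<Omega>" "exit_time \<Phi> \<Omega> 1 x < ereal (real m)" "ereal (real m) \<le> ereal (real n)"
      by (auto simp: A_def)
    then show "x \<in> A n" unfolding A_def using less_le_trans by blast
  qed
  have A_union: "(\<Union>n. A n) = finite_exit \<Phi> \<Omega> 1"
    by (auto simp: A_def finite_exit_def less_PInf_Ex_of_nat)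
  have f_exit: "set_integrable \<mu> (\<Union>n. A n) f"
    by (rule set_integrable_subset[OF f]) (use A_sets in \<open>auto simp: A_def\<close>)
  have bound: "(LINT y:\<Gamma>|completion M. LINT s=0..min (\<tau> y) (ereal (real n))|lebesgue. \<bar>f (\<Phi> y (- s))\<bar>) \<le>
      (LINT x:\<Omega>|\<mu>. \<bar>f x\<bar>)" for n
  proof -
    have "integrable \<mu> (\<lambda>x. indicat_real \<Omega> x *\<^sub>R \<bar>f x\<bar>)"
      using set_integrable_abs[OF f] by (simp add: set_integrable_def)
    moreover have "integrable \<mu> (\<lambda>x. indicat_real (A n) x *\<^sub>R \<bar>f x\<bar>)"
      using set_integrable_subset[OF set_integrable_abs[OF f] A_sets, of n]
      by (auto simp: set_integrable_def A_def)
    ultimately have "(LINT x:A n|\<mu>. \<bar>f x\<bar>) \<le> (LINT x:\<Omega>|\<mu>. \<bar>f x\<bar>)"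
      unfolding set_lebesgue_integral_def by (intro integral_mono) (auto simp: A_def indicator_def)
    then show ?thesis using truncate(2)[OF set_integrable_abs[OF f]] by simp
  qed
  note exhaust = iterated_integrable_exhaust[OF completion.complete_measure_axioms \<tau>_nonneg
      truncate(1)[OF f] truncate(1)[OF set_integrable_abs[OF f]] bound]
  have eq: "indicat_real \<Gamma> y * (indicat_real (einterval 0 (\<tau>\<Gamma> y)) s * f (\<Phi> y (- s))) =
      indicat_real \<Gamma> y * (indicat_real (einterval 0 (\<tau> y)) s * f (\<Phi> y (- s)))" for y s
    by (cases "y \<in> \<Gamma>") (simp_all add: \<tau>)
  note cong = iterated_integral_cong[OF _ _ eq, of "completion M"]
  show "iterated_integrable (completion M) \<Gamma> \<tau>\<Gamma> (\<lambda>y s. f (\<Phi> y (- s)))"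
    using exhaust(1) cong(1) \<tau>_nonneg by (simp add: \<tau>)
  have "(\<lambda>n. LINT x:A n|\<mu>. f x) \<longlonglongrightarrow> (LINT x:finite_exit \<Phi> \<Omega> 1|\<mu>. f x)"
    using set_integral_cont_up[OF A_sets A_mono f_exit] by (simp add: A_union)
  moreover have "(\<lambda>n. LINT x:A n|\<mu>. f x) \<longlonglongrightarrow>
      (LINT y:\<Gamma>|completion M. LINT s=0..\<tau> y|lebesgue. f (\<Phi> y (- s)))"
    using exhaust(2) by (simp add: truncate(2)[OF f])
  ultimately have "(LINT x:finite_exit \<Phi> \<Omega> 1|\<mu>. f x) =
      (LINT y:\<Gamma>|completion M. LINT s=0..\<tau> y|lebesgue. f (\<Phi> y (- s)))"
    by (rule LIMSEQ_unique)
  then show "(LINT x:finite_exit \<Phi> \<Omega> 1|\<mu>. f x) =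
      (LINT y:\<Gamma>|completion M. LINT s=0..\<tau>\<Gamma> y|lebesgue. f (\<Phi> y (- s)))"
    using cong(2) \<tau>_nonneg by (simp add: \<tau>)
qed

text \<open>The identity just proved, for \<open>f\<close> restricted to the points with infinite backward exit time: a
  curve ending on the boundary consists entirely of such points or contains none of them,
  according to whether its length is infinite.\<close>

lemma outgoing_identity_infinite:
  assumes \<mu>: "radon_measure \<mu>" and \<Omega>: "open \<Omega>"
    and M: "outgoing_boundary_measure \<mu> \<Phi> \<Omega> M"
    and f: "set_integrable \<mu> \<Omega> f"
  shows "iterated_integrable (completion M) (infinite_boundary \<Phi> \<Omega> 1) (\<lambda>y. \<infinity>) (\<lambda>y s. f (\<Phi> y (- s)))"
    and "(LINT x:finite_exit \<Phi> \<Omega> 1 \<inter> infinite_exit \<Phi> \<Omega> (-1)|\<mu>. f x) =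
      (LINT y:infinite_boundary \<Phi> \<Omega> 1|completion M. LINT s=0..\<infinity>|lebesgue. f (\<Phi> y (- s)))"
proof -
  define U where "U = {x. exit_time \<Phi> \<Omega> (-1) x = \<infinity>}"
  define g where "g = (\<lambda>x. indicat_real U x * f x)"
  have [measurable]: "exit_time \<Phi> \<Omega> (-1) \<in> borel_measurable \<mu>"
    by (intro radon_measure_borel_measurable[OF \<mu>] borel_measurable_exit_time \<Omega>)
  have "space \<mu> = UNIV"
    using \<mu> by (auto simp: radon_measure_def dest: sets_eq_imp_space_eq)
  then have "U = {x \<in> space \<mu>. exit_time \<Phi> \<Omega> (-1) x = \<infinity>}"
    by (simp add: U_def)
  also have "\<dots> \<in> sets \<mu>" by measurable
  finally have "integrable \<mu> (\<lambda>x. indicat_real U x *\<^sub>R (indicat_real \<Omega> x *\<^sub>R f x))"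
    using f unfolding set_integrable_def by (rule integrable_mult_indicator)
  then have g: "set_integrable \<mu> \<Omega> g"
    by (simp add: set_integrable_def g_def ac_simps)
  have curve: "\<Phi> y (- s) \<in> U \<longleftrightarrow> curve_length \<Phi> \<Omega> 1 y = \<infinity>"
    if "y \<in> flow_boundary \<Phi> \<Omega> 1" "0 < s" "ereal s < curve_length \<Phi> \<Omega> 1 y" for y s
    using backward_exit_time_boundary_curve[OF \<Omega> that] by (simp add: U_def)
  have eq: "indicat_real (infinite_boundary \<Phi> \<Omega> 1) y * (indicat_real (einterval 0 \<infinity>) s * f (\<Phi> y (- s))) =
      indicat_real (flow_boundary \<Phi> \<Omega> 1) y *
        (indicat_real (einterval 0 (curve_length \<Phi> \<Omega> 1 y)) s * g (\<Phi> y (- s)))" for y s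
    using curve[of y s]
    by (auto simp: indicator_def g_def infinite_boundary_def einterval_iff)
  note cong = iterated_integral_cong[OF _ curve_length_nonneg[OF \<Omega>] eq, of "completion M", simplified]
  show "iterated_integrable (completion M) (infinite_boundary \<Phi> \<Omega> 1) (\<lambda>y. \<infinity>) (\<lambda>y s. f (\<Phi> y (- s)))"
    using cong(1) outgoing_identity(1)[OF \<mu> \<Omega> M g] by simp
  have "(LINT x:finite_exit \<Phi> \<Omega> 1 \<inter> infinite_exit \<Phi> \<Omega> (-1)|\<mu>. f x) = (LINT x:finite_exit \<Phi> \<Omega> 1|\<mu>. g x)"
    unfolding set_lebesgue_integral_def
    by (intro Bochner_Integration.integral_cong)
      (auto simp: g_def U_def indicator_def finite_exit_def infinite_exit_def)
  then show "(LINT x:finite_exit \<Phi> \<Omega> 1 \<inter> infinite_exit \<Phi> \<Omega> (-1)|\<mu>. f x) =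
      (LINT y:infinite_boundary \<Phi> \<Omega> 1|completion M. LINT s=0..\<infinity>|lebesgue. f (\<Phi> y (- s)))"
    using cong(2) outgoing_identity(2)[OF \<mu> \<Omega> M g] by simp
qed

end

section \<open>Both boundaries\<close>

theorem proposition2p12:
  fixes \<mu> \<mu>\<^sub>p \<mu>\<^sub>m :: "(real ^ 'n) measure"
    and F :: "real ^ 'n \<Rightarrow> real ^ 'n"
    and \<Phi> :: "real ^ 'n \<Rightarrow> real \<Rightarrow> real ^ 'n"
    and \<Omega> :: "(real ^ 'n) set"
    and f :: "real ^ 'n \<Rightarrow> real"
  assumes "radon_measure \<mu>"
    and "\<exists>L. L-lipschitz_on UNIV F"
    and "global_flow F \<Phi>"
    and "flow_invariant \<mu> \<Phi>"
    and "open \<Omega>"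
    and "outgoing_boundary_measure \<mu> \<Phi> \<Omega> \<mu>\<^sub>p"
    and "incoming_boundary_measure \<mu> \<Phi> \<Omega> \<mu>\<^sub>m"
    and "set_integrable \<mu> \<Omega> f"
  shows
    "(iterated_integrable (completion \<mu>\<^sub>p) (flow_boundary \<Phi> \<Omega> 1)
       (curve_length \<Phi> \<Omega> 1) (\<lambda>y s. f (\<Phi> y (- s))) \<and>
     (LINT x:finite_exit \<Phi> \<Omega> 1|\<mu>. f x) =
       (LINT y:flow_boundary \<Phi> \<Omega> 1|completion \<mu>\<^sub>p.
          LINT s=0..curve_length \<Phi> \<Omega> 1 y|lebesgue. f (\<Phi> y (- s)))) \<and>
     (iterated_integrable (completion \<mu>\<^sub>m) (flow_boundary \<Phi> \<Omega> (-1))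
       (curve_length \<Phi> \<Omega> (-1)) (\<lambda>y s. f (\<Phi> y s)) \<and>
     (LINT x:finite_exit \<Phi> \<Omega> (-1)|\<mu>. f x) =
       (LINT y:flow_boundary \<Phi> \<Omega> (-1)|completion \<mu>\<^sub>m.
          LINT s=0..curve_length \<Phi> \<Omega> (-1) y|lebesgue. f (\<Phi> y s))) \<and>
     (iterated_integrable (completion \<mu>\<^sub>p) (infinite_boundary \<Phi> \<Omega> 1)
       (\<lambda>y. \<infinity>) (\<lambda>y s. f (\<Phi> y (- s))) \<and>
     (LINT x:finite_exit \<Phi> \<Omega> 1 \<inter> infinite_exit \<Phi> \<Omega> (-1)|\<mu>. f x) =
       (LINT y:infinite_boundary \<Phi> \<Omega> 1|completion \<mu>\<^sub>p.
          LINT s=0..\<infinity>|lebesgue. f (\<Phi> y (- s)))) \<and>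
     (iterated_integrable (completion \<mu>\<^sub>m) (infinite_boundary \<Phi> \<Omega> (-1))
       (\<lambda>y. \<infinity>) (\<lambda>y s. f (\<Phi> y s)) \<and>
     (LINT x:finite_exit \<Phi> \<Omega> (-1) \<inter> infinite_exit \<Phi> \<Omega> 1|\<mu>. f x) =
       (LINT y:infinite_boundary \<Phi> \<Omega> (-1)|completion \<mu>\<^sub>m.
          LINT s=0..\<infinity>|lebesgue. f (\<Phi> y s)))"
proof -
  let ?\<Psi> = "\<lambda>x t. \<Phi> x (- t)"
  obtain L where "L-lipschitz_on UNIV F" using assms(2) by blast
  then have \<Phi>: "continuous_flow \<Phi>"
    using assms(3) by (rule global_flow_continuous_flow)
  then interpret forward: continuous_flow \<Phi> .
  interpret backward: continuous_flow ?\<Psi>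
    using \<Phi> by (rule continuous_flow_reverse)
  have M: "outgoing_boundary_measure \<mu> ?\<Psi> \<Omega> \<mu>\<^sub>m"
    using assms(7) by (rule incoming_imp_outgoing_reverse)
  have "exit_time ?\<Psi> \<Omega> \<sigma> x = exit_time \<Phi> \<Omega> (- \<sigma>) x" for \<sigma> x
    by (simp add: exit_time_def)
  then have reverse: "finite_exit ?\<Psi> \<Omega> 1 = finite_exit \<Phi> \<Omega> (-1)"
    "infinite_exit ?\<Psi> \<Omega> (-1) = infinite_exit \<Phi> \<Omega> 1"
    "infinite_boundary ?\<Psi> \<Omega> 1 = infinite_boundary \<Phi> \<Omega> (-1)"
    by (simp_all add: finite_exit_def infinite_exit_def infinite_boundary_def
        flow_boundary_reverse curve_length_reverse)
  have "curve_length ?\<Psi> \<Omega> 1 = curve_length \<Phi> \<Omega> (-1)"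
    by (rule ext) (rule curve_length_reverse)
  note reverse = reverse flow_boundary_reverse this
  show ?thesis
    using forward.outgoing_identity[OF assms(1,5,6,8)]
      forward.outgoing_identity_infinite[OF assms(1,5,6,8)]
      backward.outgoing_identity[OF assms(1,5) M assms(8)]
      backward.outgoing_identity_infinite[OF assms(1,5) M assms(8)]
    unfolding reverse minus_minus by blast
qed

end
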